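(* Let $\alpha>0$. The limiting (as $n\to\infty$, in the sense of weak convergence) expected empirical distribution of the points of $n^{-1/\alpha}.\mathcal X_n^{(\alpha)}=\{n^{-1/\alpha}z: z\in\mathcal X_n^{(\alpha)}\}$ is $\mu^{(\alpha)}$, where $$d\mu^{(\alpha)}(re^{i\theta})=\begin{cases}\frac{\alpha^2}{4\pi}r^{\alpha-1}\,dr\,d\theta& 0<r<\left(\frac2\alpha\right)^{1/\alpha},\ 0\le\theta\le2\pi\\0&\text{otherwise.}\end{cases}$$
   Context: For $\alpha>0$, $\mathcal X_n^{(\alpha)}$ is the determinantal point process of $n$ points in $\mathbb C$ with kernel $\mathbb K_n^{(\alpha)}(z,w)=\frac\alpha{2\pi}\sum_{k=0}^{n-1}\frac{(z\bar w)^k}{\Gamma(\frac2\alpha(k+1))}e^{-\frac{|z|^\alpha}2-\frac{|w|^\alpha}2}$ with respect to Lebesgue measure; equivalently, the vector of its points in uniform random order has density $\frac{\alpha^n}{n!(2\pi)^n\prod_{k=0}^{n-1}\Gamma(\frac2\alpha(k+1))}e^{-\sum_{k=1}^n|z_k|^\alpha}\prod_{i<j}|z_i-z_j|^2$ with respect to Lebesgue measure on $\mathbb C^n$. The expected empirical distribution of a random set of $n$ points $\{w_1,\dots,w_n\}$ is the probability measure $B\mapsto\frac1n\mathbf E\,|\{k: w_k\in B\}|$ on Borel sets $B\subset\mathbb C$. *)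

theory Defs
  imports "HOL-Probability.Probability" "Jordan_Normal_Form.Determinant"
begin

text \<open>Point processes are random sets of points.  Simplicity (no multiple points) is therefore
  automatic, and the number of points in \<open>B\<close> is the cardinality of \<open>X \<omega> \<inter> B\<close>.\<close>

definition n_point_process :: "'w measure \<Rightarrow> nat \<Rightarrow> ('w \<Rightarrow> complex set) \<Rightarrow> bool" where
  "n_point_process M n X \<longleftrightarrow>
     prob_space M \<and>
     (AE \<omega> in M. finite (X \<omega>) \<and> card (X \<omega>) = n) \<and>
     (\<forall>B \<in> sets borel. (\<lambda>\<omega>. card (X \<omega> \<inter> B)) \<in> measurable M (count_space UNIV))"

text \<open>The \<open>k\<close>-point joint intensity (correlation function) with respect to Lebesgue measure on
  \<open>\<complex>\<close>: \<open>E [\<Prod>i<k. |X \<inter> B\<^sub>i|] = \<integral> \<rho>\<close> over \<open>B\<^sub>0 \<times> \<dots> \<times> B\<^sub>k\<^sub>-\<^sub>1\<close> for pairwise disjoint Borel sets.\<close>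

definition joint_intensity ::
    "'w measure \<Rightarrow> ('w \<Rightarrow> complex set) \<Rightarrow> nat \<Rightarrow> ((nat \<Rightarrow> complex) \<Rightarrow> real) \<Rightarrow> bool" where
  "joint_intensity M X k \<rho> \<longleftrightarrow>
     \<rho> \<in> borel_measurable (Pi\<^sub>M {..<k} (\<lambda>_. lborel)) \<and>
     (\<forall>x. 0 \<le> \<rho> x) \<and>
     (\<forall>B. (\<forall>i<k. B i \<in> sets borel) \<and> disjoint_family_on B {..<k} \<longrightarrow>
        (\<integral>\<^sup>+ \<omega>. (\<Prod>i<k. of_nat (card (X \<omega> \<inter> B i))) \<partial>M) =
        (\<integral>\<^sup>+ x \<in> Pi\<^sub>E {..<k} B. ennreal (\<rho> x) \<partial>(Pi\<^sub>M {..<k} (\<lambda>_. lborel))))"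

definition determinantal_process ::
    "'w measure \<Rightarrow> nat \<Rightarrow> (complex \<Rightarrow> complex \<Rightarrow> complex) \<Rightarrow> ('w \<Rightarrow> complex set) \<Rightarrow> bool" where
  "determinantal_process M n K X \<longleftrightarrow>
     n_point_process M n X \<and>
     (\<forall>k. \<exists>\<rho>. joint_intensity M X k \<rho> \<and>
        (\<forall>x. complex_of_real (\<rho> x) = Determinant.det (Matrix.mat k k (\<lambda>(i, j). K (x i) (x j)))))"

definition alpha_kernel :: "real \<Rightarrow> nat \<Rightarrow> complex \<Rightarrow> complex \<Rightarrow> complex" where
  "alpha_kernel \<alpha> n z w =
     of_real (\<alpha> / (2 * pi)) *
     (\<Sum>k<n. (z * cnj w) ^ k / of_real (Gamma (2 / \<alpha> * (real k + 1))) *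
        of_real (exp (- (norm z powr \<alpha>) / 2 - (norm w powr \<alpha>) / 2)))"

definition dilate :: "real \<Rightarrow> complex set \<Rightarrow> complex set" where
  "dilate c A = (\<lambda>z. of_real c * z) ` A"

definition expected_empirical :: "'w measure \<Rightarrow> nat \<Rightarrow> ('w \<Rightarrow> complex set) \<Rightarrow> complex measure" where
  "expected_empirical M n W =
     measure_of UNIV (sets borel) (\<lambda>B. (\<integral>\<^sup>+ \<omega>. of_nat (card (W \<omega> \<inter> B)) \<partial>M) / of_nat n)"

definition borel_prob :: "'a::topological_space measure \<Rightarrow> bool" where
  "borel_prob \<mu> \<longleftrightarrow> prob_space \<mu> \<and> sets \<mu> = sets borel"

text \<open>The library's \<open>weak_conv_m\<close> is phrased through distribution functions and hence restricted to
  measures on the real line.  Only eventually all \<open>\<mu>s n\<close> need be probability measures, since the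
  expected empirical distribution makes no sense for \<open>n = 0\<close>.\<close>

definition weakly_converges ::
    "(nat \<Rightarrow> 'a::topological_space measure) \<Rightarrow> 'a measure \<Rightarrow> bool" where
  "weakly_converges \<mu>s \<mu> \<longleftrightarrow>
     (\<forall>\<^sub>F n in sequentially. borel_prob (\<mu>s n)) \<and> borel_prob \<mu> \<and>
     (\<forall>f :: 'a \<Rightarrow> real. continuous_on UNIV f \<and> bounded (range f) \<longrightarrow>
        (\<lambda>n. \<integral>x. f x \<partial>\<mu>s n) \<longlonglongrightarrow> (\<integral>x. f x \<partial>\<mu>))"

text \<open>A measure given in polar coordinates by \<open>d\<mu>(r e\<^sup>i\<^sup>\<theta>) = g r \<theta> dr d\<theta>\<close> is the image under
  \<open>(r, \<theta>) \<mapsto> r e\<^sup>i\<^sup>\<theta>\<close> of the measure with density \<open>g\<close> with respect to \<open>dr d\<theta>\<close>; no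
  Jacobian factor \<open>r\<close> is added.\<close>

definition limit_measure :: "real \<Rightarrow> complex measure" where
  "limit_measure \<alpha> =
     distr
       (density (lborel :: (real \<times> real) measure)
          (\<lambda>(r, \<theta>). ennreal
             (if 0 < r \<and> r < (2 / \<alpha>) powr (1 / \<alpha>) \<and> 0 \<le> \<theta> \<and> \<theta> \<le> 2 * pi
              then \<alpha>\<^sup>2 / (4 * pi) * r powr (\<alpha> - 1) else 0)))
       borel (\<lambda>(r, \<theta>). of_real r * cis \<theta>)"

end

theory Submission
  imports Defs
begin

text \<open>
  The one-point intensity of the process is the kernel on the diagonal, a sum over \<open>k < n\<close> of radial
  probability densities proportional to \<open>|z|\<^sup>2\<^sup>k exp (- |z|\<^sup>\<alpha>)\<close>.  In polar coordinates with
  \<open>t = |z|\<^sup>\<alpha>\<close> as radial variable, the \<open>k\<close>-th of these is the law of a uniform angle together with an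
  independent \<open>T\<^sub>k\<close> that is gamma distributed with shape \<open>a (k + 1)\<close>, where \<open>a = 2/\<alpha>\<close>
  (lemma \<open>density_radial_density\<close>).  Scaling the plane by \<open>n powr (- 1/\<alpha>)\<close> divides \<open>t\<close> by \<open>n\<close>.  Hence,
  for a bounded continuous \<open>f\<close> with circular means \<open>F t\<close>, the integral of \<open>f\<close> against the
  expected empirical distribution is the average over \<open>k < n\<close> of the expectations of \<open>F (T\<^sub>k / n)\<close>
  (lemma \<open>integral_rescaled_mean_radial_density\<close>).

  Both the mean and the variance of \<open>T\<^sub>k\<close> are \<open>a (k + 1)\<close>, so \<open>T\<^sub>k / n\<close> concentrates at
  \<open>a (k + 1) / n\<close>, uniformly in \<open>k < n\<close>, and the average is asymptotically a Riemann sum, with limit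
  \<open>1/a\<close> times the integral of \<open>F\<close> over \<open>[0, a]\<close> (lemma \<open>gamma_average_tendsto\<close>).  In the same
  coordinates the limit measure is the law of a uniform angle and an independent uniform
  \<open>t\<close> in \<open>(0, a)\<close> (lemma \<open>limit_measure_eq_distr_powr_polar\<close>), so its integral of \<open>f\<close> is that limit.

  Lebesgue measure on the plane is brought to polar coordinates by one-dimensional
  substitutions and Fubini's theorem (lemma \<open>nn_integral_lborel_polar\<close>).
\<close>

section \<open>Substitution in one-dimensional integrals\<close>

lemma nn_integral_indicator_UN_incseq:
  fixes h :: "'a \<Rightarrow> ennreal"
  assumes [measurable]: "h \<in> borel_measurable M" and A: "\<And>j::nat. A j \<in> sets M" "incseq A"
  shows "(\<integral>\<^sup>+x. h x * indicator (\<Union>j. A j) x \<partial>M) = (SUP j. \<integral>\<^sup>+x. h x * indicator (A j) x \<partial>M)"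
proof -
  have "(SUP j. emeasure (density M h) (A j)) = emeasure (density M h) (\<Union>j. A j)"
    using A by (intro SUP_emeasure_incseq) auto
  then show ?thesis
    using A by (simp add: emeasure_density sets.countable_UN)
qed

text \<open>Substitution on an interval \<open>S\<close> that need not be compact, with \<open>g'\<close> possibly singular at the
  ends of \<open>S\<close>: monotone convergence along an exhaustion by compact intervals.  This form covers both
  \<open>tan\<close> on an open bounded interval and \<open>x powr p\<close> at \<open>0\<close>.\<close>
lemma nn_integral_substitution_exhaustion:
  fixes f :: "real \<Rightarrow> ennreal" and g g' :: "real \<Rightarrow> real" and a b :: "nat \<Rightarrow> real"
  assumes [measurable]: "f \<in> borel_measurable borel" "g \<in> borel_measurable borel"
      "g' \<in> borel_measurable borel"
    and S: "S = (\<Union>j. {a j..b j})" and T: "T = (\<Union>j. {g (a j)..g (b j)})"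
    and ab: "decseq a" "incseq b" "\<And>j. a j < b j"
    and deriv: "\<And>x. x \<in> S \<Longrightarrow> (g has_real_derivative g' x) (at x)"
    and cont: "continuous_on S g'" and nonneg: "\<And>x. x \<in> S \<Longrightarrow> 0 \<le> g' x"
  shows "(\<integral>\<^sup>+x. f x * indicator T x \<partial>lborel) = (\<integral>\<^sup>+x. f (g x) * g' x * indicator S x \<partial>lborel)"
proof -
  have sub: "{a j..b j} \<subseteq> S" for j
    using S by auto
  have mono: "g x \<le> g y" if "x \<le> y" "{x..y} \<subseteq> S" for x y
    using that deriv nonneg by (intro deriv_nonneg_imp_mono[of x y g g']) (auto simp: subset_eq)
  have le: "{a i..b i} \<subseteq> {a j..b j}" if "i \<le> j" for i j
    using decseqD[OF ab(1) that] incseqD[OF ab(2) that] by auto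
  have ai: "a i \<in> {a j..b j}" "b i \<in> {a j..b j}" if "i \<le> j" for i j
    using le[OF that] ab(3)[of i] by auto
  have le': "{g (a i)..g (b i)} \<subseteq> {g (a j)..g (b j)}" if "i \<le> j" for i j
  proof -
    have "g (a j) \<le> g (a i)" 
      using sub[of j] ai[OF that] by (intro mono) auto
    moreover have "g (b i) \<le> g (b j)"
      using sub[of j] ai[OF that] by (intro mono) auto
    ultimately show ?thesis by auto
  qed
  have "(\<integral>\<^sup>+x. f x * indicator T x \<partial>lborel)
      = (SUP j. \<integral>\<^sup>+x. f x * indicator {g (a j)..g (b j)} x \<partial>lborel)"
    unfolding T by (intro nn_integral_indicator_UN_incseq) (use le' in \<open>auto simp: incseq_def\<close>)
  also have "\<dots> = (SUP j. \<integral>\<^sup>+x. f (g x) * g' x * indicator {a j..b j} x \<partial>lborel)"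
  proof (intro SUP_cong nn_integral_substitution_aux refl)
    fix j
    show "continuous_on {a j..b j} g'"
      using cont sub by (rule continuous_on_subset)
  qed (use sub ab(3) deriv nonneg in \<open>auto simp: subset_eq\<close>)
  also have "\<dots> = (\<integral>\<^sup>+x. f (g x) * g' x * indicator S x \<partial>lborel)"
    unfolding S
    by (intro nn_integral_indicator_UN_incseq[symmetric]) (use le in \<open>auto simp: incseq_def\<close>)
  finally show ?thesis .
qed

lemma nn_integral_substitution_tan:
  fixes f :: "real \<Rightarrow> ennreal"
  assumes [measurable]: "f \<in> borel_measurable borel"
  shows "(\<integral>\<^sup>+x. f x \<partial>lborel)
    = (\<integral>\<^sup>+x. f (tan x) * inverse ((cos x)\<^sup>2) * indicator {-pi/2<..<pi/2} x \<partial>lborel)"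
proof -
  have ex: "\<exists>j::nat. \<bar>x\<bar> \<le> 1 + real j" for x :: real
  proof -
    obtain j :: nat where "\<bar>x\<bar> \<le> real j" using real_arch_simple by blast
    then show ?thesis by (intro exI[of _ j]) linarith
  qed
  have S: "{-pi/2<..<pi/2} = (\<Union>j. {arctan (-1 - real j)..arctan (1 + real j)})" (is "_ = ?S")
  proof (intro equalityI subsetI)
    fix x assume x: "x \<in> {-pi/2<..<pi/2}"
    obtain j :: nat where "\<bar>tan x\<bar> \<le> 1 + real j" using ex by blast
    then have "arctan (-1 - real j) \<le> arctan (tan x)" "arctan (tan x) \<le> arctan (1 + real j)"
      by (auto simp: arctan_le_iff)
    moreover have "arctan (tan x) = x"
      using x by (intro arctan_tan) auto
    ultimately show "x \<in> ?S" by auto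
  next
    fix x assume "x \<in> ?S"
    then obtain j where "arctan (-1 - real j) \<le> x" "x \<le> arctan (1 + real j)" by auto
    moreover have "-(pi/2) < arctan (-1 - real j)" "arctan (1 + real j) < pi/2"
      by (rule arctan_lbound arctan_ubound)+
    ultimately show "x \<in> {-pi/2<..<pi/2}" by auto
  qed
  have T: "UNIV = (\<Union>j. {tan (arctan (-1 - real j))..tan (arctan (1 + real j))})"
  proof (intro equalityI subsetI)
    fix x :: real
    obtain j :: nat where "\<bar>x\<bar> \<le> 1 + real j" using ex by blast
    then show "x \<in> (\<Union>j. {tan (arctan (-1 - real j))..tan (arctan (1 + real j))})"
      by (auto simp: tan_arctan intro!: exI[of _ j])
  qed auto
  have nz: "cos x \<noteq> 0" if "x \<in> {-pi/2<..<pi/2}" for x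
    using that cos_gt_zero_pi[of x] by auto
  have "(\<integral>\<^sup>+x. f x * indicator UNIV x \<partial>lborel)
    = (\<integral>\<^sup>+x. f (tan x) * inverse ((cos x)\<^sup>2) * indicator {-pi/2<..<pi/2} x \<partial>lborel)"
  proof (rule nn_integral_substitution_exhaustion[OF _ _ _ S T])
    show "(tan :: real \<Rightarrow> real) \<in> borel_measurable borel"
      unfolding tan_def by measurable
    show "continuous_on {-pi/2<..<pi/2} (\<lambda>x. inverse ((cos x)\<^sup>2))"
      using nz by (intro continuous_intros) auto
    show "(tan has_real_derivative inverse ((cos x)\<^sup>2)) (at x)" if "x \<in> {-pi/2<..<pi/2}" for x
      by (rule DERIV_tan[OF nz[OF that]])
    show "decseq (\<lambda>j. arctan (-1 - real j))" "incseq (\<lambda>j. arctan (1 + real j))"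
      by (auto simp: decseq_def incseq_def arctan_le_iff)
  qed (auto simp: arctan_less_iff)
  then show ?thesis by simp
qed

lemma nn_integral_substitution_powr:
  fixes f :: "real \<Rightarrow> ennreal" and p :: real
  assumes [measurable]: "f \<in> borel_measurable borel" and p: "0 < p"
  shows "(\<integral>\<^sup>+x. f x * indicator {0<..} x \<partial>lborel)
    = (\<integral>\<^sup>+x. f (x powr p) * (p * x powr (p - 1)) * indicator {0<..} x \<partial>lborel)"
proof -
  have ex: "\<exists>j::nat. inverse (2 + real j) \<le> x \<and> x \<le> 2 + real j" if x: "x > 0" for x :: real
  proof -
    obtain j :: nat where j: "max x (inverse x) \<le> real j"
      using real_arch_simple by blast
    then have "inverse (2 + real j) \<le> inverse (inverse x)"
      using x by (intro le_imp_inverse_le) auto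
    then show ?thesis using j by (intro exI[of _ j]) auto
  qed
  have T: "{0<..} = (\<Union>j. {inverse (2 + real j)..2 + real j})"
  proof (intro equalityI subsetI)
    fix x assume "x \<in> (\<Union>j. {inverse (2 + real j)..2 + real j})"
    then obtain j where "inverse (2 + real j) \<le> x" by auto
    moreover have "0 < inverse (2 + real j)" by auto
    ultimately show "x \<in> {0<..}" unfolding greaterThan_iff by linarith
  qed (use ex in auto)
  \<comment> \<open>The exhaustion of the source is the preimage of that of the target, under the inverse \<open>q\<close>.\<close>
  define q where "q = (\<lambda>x::real. x powr (1/p))"
  have qp: "q x powr p = x" if "x > 0" for x
    using that p by (simp add: q_def powr_powr)
  have pq: "q (x powr p) = x" if "x > 0" for x
    using that p by (simp add: q_def powr_powr)
  have q_mono: "q x \<le> q y" if "0 \<le> x" "x \<le> y" for x y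
    using that p by (auto simp: q_def intro: powr_mono2)
  have q_mono': "q x < q y" if "0 \<le> x" "x < y" for x y
    using that p by (auto simp: q_def intro: powr_less_mono2)
  have S: "{0<..} = (\<Union>j. {q (inverse (2 + real j))..q (2 + real j)})"
  proof (intro equalityI subsetI)
    fix x assume x: "x \<in> {0::real<..}"
    then obtain j where "inverse (2 + real j) \<le> x powr p" "x powr p \<le> 2 + real j"
      using ex[of "x powr p"] by auto
    then have "q (inverse (2 + real j)) \<le> q (x powr p)" "q (x powr p) \<le> q (2 + real j)"
      by (auto intro!: q_mono)
    then show "x \<in> (\<Union>j. {q (inverse (2 + real j))..q (2 + real j)})" using x pq by auto
  next
    fix x assume "x \<in> (\<Union>j. {q (inverse (2 + real j))..q (2 + real j)})"
    then obtain j where "q (inverse (2 + real j)) \<le> x" by auto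
    moreover have "0 < q (inverse (2 + real j))" by (auto simp: q_def)
    ultimately show "x \<in> {0<..}" unfolding greaterThan_iff by linarith
  qed
  have T': "{0<..} = (\<Union>j. {q (inverse (2 + real j)) powr p..q (2 + real j) powr p})"
    unfolding T by (simp add: qp)
  show ?thesis
  proof (rule nn_integral_substitution_exhaustion[OF _ _ _ S T'])
    show "continuous_on {0<..} (\<lambda>x. p * x powr (p - 1))"
      by (intro continuous_intros) auto
    show "((\<lambda>x. x powr p) has_real_derivative p * x powr (p - 1)) (at x)" if "x \<in> {0<..}" for x
      using that by (auto intro!: derivative_eq_intros)
    show "decseq (\<lambda>j. q (inverse (2 + real j)))"
      by (auto simp: decseq_def intro!: q_mono le_imp_inverse_le)
    show "incseq (\<lambda>j. q (2 + real j))"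
      by (auto simp: incseq_def intro!: q_mono)
    show "q (inverse (2 + real j)) < q (2 + real j)" for j
    proof (rule q_mono')
      have "inverse (2 + real j) \<le> inverse 1" by (rule le_imp_inverse_le) auto
      then show "inverse (2 + real j) < 2 + real j" by simp
    qed auto
  qed (use p in auto)
qed

lemma lborel_complex_eq_distr:
  "(lborel :: complex measure) = distr (lborel \<Otimes>\<^sub>M lborel) borel (\<lambda>(x, y). Complex x y)"
proof (rule lborel_eqI)
  have [measurable]: "(\<lambda>(x, y). Complex x y) \<in> borel_measurable (lborel \<Otimes>\<^sub>M lborel)"
    unfolding Complex_eq by measurable
  fix l u :: complex assume "\<And>b. b \<in> Basis \<Longrightarrow> inner l b \<le> inner u b"
  from this[of 1] this[of \<i>] have le: "Re l \<le> Re u" "Im l \<le> Im u"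
    by (simp_all add: Basis_complex_def)
  have "(\<lambda>(x, y). Complex x y) -` box l u = {Re l<..<Re u} \<times> {Im l<..<Im u}"
    by (auto simp: box_def Basis_complex_def)
  then show "emeasure (distr (lborel \<Otimes>\<^sub>M lborel) borel (\<lambda>(x, y). Complex x y)) (box l u)
      = ennreal (\<Prod>b\<in>Basis. inner (u - l) b)"
    using le
    by (simp add: emeasure_distr space_pair_measure lborel.emeasure_pair_measure_Times
        Basis_complex_def ennreal_mult[symmetric])
qed simp

lemma nn_integral_lborel_complex:
  fixes f :: "complex \<Rightarrow> ennreal"
  assumes [measurable]: "f \<in> borel_measurable borel"
  shows "(\<integral>\<^sup>+z. f z \<partial>lborel) = (\<integral>\<^sup>+x. \<integral>\<^sup>+y. f (Complex x y) \<partial>lborel \<partial>lborel)"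
proof -
  have [measurable]: "(\<lambda>(x, y). Complex x y) \<in> borel_measurable (lborel \<Otimes>\<^sub>M lborel)"
    unfolding Complex_eq by measurable
  have "(\<integral>\<^sup>+z. f z \<partial>lborel) = (\<integral>\<^sup>+z. f (case z of (x, y) \<Rightarrow> Complex x y) \<partial>(lborel \<Otimes>\<^sub>M lborel))"
    by (subst lborel_complex_eq_distr) (simp add: nn_integral_distr)
  also have "\<dots> = (\<integral>\<^sup>+x. \<integral>\<^sup>+y. f (Complex x y) \<partial>lborel \<partial>lborel)"
    by (subst lborel.nn_integral_fst[symmetric]) auto
  finally show ?thesis .
qed

section \<open>Polar coordinates in the complex plane\<close>

lemma borel_measurable_cis [measurable]: "cis \<in> borel_measurable borel"
  by (intro borel_measurable_continuous_onI continuous_intros)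

text \<open>On the half plane \<open>Re z > 0\<close>, polar coordinates need no two-dimensional change of variables:
  substitute \<open>y = x t\<close> and \<open>t = tan \<theta>\<close> in the inner integral, exchange the integrals, and substitute
  \<open>x = r cos \<theta>\<close>.  The factors \<open>x\<close>, \<open>1 / (cos \<theta>)\<^sup>2\<close> and \<open>cos \<theta>\<close> multiply to \<open>r\<close>.\<close>
lemma nn_integral_right_half_plane:
  fixes f :: "complex \<Rightarrow> ennreal"
  assumes [measurable]: "f \<in> borel_measurable borel"
  shows "(\<integral>\<^sup>+z. f z * indicator {z. 0 < Re z} z \<partial>lborel)
    = (\<integral>\<^sup>+\<theta>. (\<integral>\<^sup>+r. f (of_real r * cis \<theta>) * (ennreal r * indicator {0<..} r) \<partial>lborel)
          * indicator {-pi/2<..<pi/2} \<theta> \<partial>lborel)"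
proof -
  have [measurable]: "(tan :: real \<Rightarrow> real) \<in> borel_measurable borel"
    unfolding tan_def by measurable
  define h :: "real \<Rightarrow> real \<Rightarrow> ennreal" where
    "h x \<theta> = f (of_real x + \<i> * of_real (x * tan \<theta>)) * inverse ((cos \<theta>)\<^sup>2)
      * indicator {-pi/2<..<pi/2} \<theta> * (ennreal x * indicator {0<..} x)" for x \<theta>
  have [measurable]: "case_prod h \<in> borel_measurable (lborel \<Otimes>\<^sub>M lborel)"
    unfolding h_def by measurable
  have "(\<integral>\<^sup>+z. f z * indicator {z. 0 < Re z} z \<partial>lborel)
      = (\<integral>\<^sup>+x. (\<integral>\<^sup>+y. f (of_real x + \<i> * of_real y) * indicator {0<..} x \<partial>lborel) \<partial>lborel)"
    by (subst nn_integral_lborel_complex) (auto simp: Complex_eq indicator_def intro!: nn_integral_cong)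
  also have "\<dots> = (\<integral>\<^sup>+x. \<integral>\<^sup>+\<theta>. h x \<theta> \<partial>lborel \<partial>lborel)"
  proof (rule nn_integral_cong)
    fix x :: real
    show "(\<integral>\<^sup>+y. f (of_real x + \<i> * of_real y) * indicator {0<..} x \<partial>lborel)
        = (\<integral>\<^sup>+\<theta>. h x \<theta> \<partial>lborel)"
    proof (cases "x > 0")
      case True
      have "(\<integral>\<^sup>+y. f (of_real x + \<i> * of_real y) \<partial>lborel)
          = ennreal x * (\<integral>\<^sup>+y. f (of_real x + \<i> * of_real (x * y)) \<partial>lborel)"
        using True by (subst nn_integral_real_affine[where c = x and t = 0]) auto
      also have "\<dots> = (\<integral>\<^sup>+\<theta>. h x \<theta> \<partial>lborel)"
        using True unfolding h_def
        by (subst nn_integral_substitution_tan) (auto simp: nn_integral_cmult[symmetric] mult_ac)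
      finally show ?thesis using True by simp
    qed (simp add: h_def)
  qed
  also have "\<dots> = (\<integral>\<^sup>+\<theta>. \<integral>\<^sup>+x. h x \<theta> \<partial>lborel \<partial>lborel)"
    by (rule lborel_pair.Fubini') measurable
  also have "\<dots> = (\<integral>\<^sup>+\<theta>. (\<integral>\<^sup>+r. f (of_real r * cis \<theta>) * (ennreal r * indicator {0<..} r) \<partial>lborel)
          * indicator {-pi/2<..<pi/2} \<theta> \<partial>lborel)"
  proof (rule nn_integral_cong)
    fix \<theta> :: real
    show "(\<integral>\<^sup>+x. h x \<theta> \<partial>lborel)
      = (\<integral>\<^sup>+r. f (of_real r * cis \<theta>) * (ennreal r * indicator {0<..} r) \<partial>lborel)
          * indicator {-pi/2<..<pi/2} \<theta>"
    proof (cases "\<theta> \<in> {-pi/2<..<pi/2}")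
      case True
      then have c: "cos \<theta> > 0"
        using cos_gt_zero_pi[of \<theta>] by auto
      have "(\<integral>\<^sup>+x. h x \<theta> \<partial>lborel) = ennreal (cos \<theta>) * (\<integral>\<^sup>+r. h (cos \<theta> * r) \<theta> \<partial>lborel)"
        using c by (subst nn_integral_real_affine[where c = "cos \<theta>" and t = 0]) auto
      also have "\<dots> = (\<integral>\<^sup>+r. ennreal (cos \<theta>) * h (cos \<theta> * r) \<theta> \<partial>lborel)"
        by (rule nn_integral_cmult[symmetric]) measurable
      also have "\<dots> = (\<integral>\<^sup>+r. f (of_real r * cis \<theta>) * (ennreal r * indicator {0<..} r) \<partial>lborel)"
      proof (rule nn_integral_cong)
        fix r :: real
        show "ennreal (cos \<theta>) * h (cos \<theta> * r) \<theta>
            = f (of_real r * cis \<theta>) * (ennreal r * indicator {0<..} r)"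
        proof (cases "r > 0")
          case r: True
          have 1: "complex_of_real (cos \<theta> * r) + \<i> * of_real (cos \<theta> * r * tan \<theta>) = of_real r * cis \<theta>"
            using c by (simp add: complex_eq_iff tan_def)
          have "ennreal (cos \<theta>) * h (cos \<theta> * r) \<theta>
              = f (of_real r * cis \<theta>)
                * (ennreal (cos \<theta>) * (ennreal (inverse ((cos \<theta>)\<^sup>2)) * ennreal (cos \<theta> * r)))"
            using True r c unfolding h_def 1 by (simp add: mult_ac)
          also have "ennreal (cos \<theta>) * (ennreal (inverse ((cos \<theta>)\<^sup>2)) * ennreal (cos \<theta> * r)) = ennreal r"
            using c r by (simp add: ennreal_mult[symmetric] power2_eq_square field_simps)
          finally show ?thesis using r by simp
        qed (use c in \<open>simp add: h_def zero_less_mult_iff\<close>)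
      qed
      finally show ?thesis using True by simp
    qed (simp add: h_def)
  qed
  finally show ?thesis .
qed

lemma nn_integral_lborel_complex_uminus:
  fixes f :: "complex \<Rightarrow> ennreal"
  assumes [measurable]: "f \<in> borel_measurable borel"
  shows "(\<integral>\<^sup>+z. f (- z) \<partial>lborel) = (\<integral>\<^sup>+z. f z \<partial>lborel)"
proof -
  have [measurable]: "(\<lambda>x. \<integral>\<^sup>+y. f (of_real x + \<i> * of_real y) \<partial>lborel) \<in> borel_measurable borel"
    by measurable
  have "(\<integral>\<^sup>+z. f z \<partial>lborel) = (\<integral>\<^sup>+x. \<integral>\<^sup>+y. f (of_real x + \<i> * of_real y) \<partial>lborel \<partial>lborel)"
    by (simp add: nn_integral_lborel_complex Complex_eq)
  also have "\<dots> = (\<integral>\<^sup>+x. \<integral>\<^sup>+y. f (of_real (-x) + \<i> * of_real y) \<partial>lborel \<partial>lborel)"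
    by (subst nn_integral_real_affine[where c = "-1" and t = 0]) auto
  also have "\<dots> = (\<integral>\<^sup>+x. \<integral>\<^sup>+y. f (of_real (-x) + \<i> * of_real (-y)) \<partial>lborel \<partial>lborel)"
    by (rule nn_integral_cong, subst nn_integral_real_affine[where c = "-1" and t = 0]) auto
  also have "\<dots> = (\<integral>\<^sup>+z. f (- z) \<partial>lborel)"
    by (simp add: nn_integral_lborel_complex Complex_eq)
  finally show ?thesis by simp
qed

text \<open>Reflection in the origin carries the right half plane to the left one and shifts the angle by
  \<open>\<pi>\<close>; the imaginary axis is null.  Periodicity then turns the angles \<open>(-\<pi>/2, 3\<pi>/2)\<close> into
  \<open>[0, 2\<pi>]\<close>.\<close>
lemma nn_integral_lborel_polar:
  fixes f :: "complex \<Rightarrow> ennreal"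
  assumes [measurable]: "f \<in> borel_measurable borel"
  shows "(\<integral>\<^sup>+z. f z \<partial>lborel)
    = (\<integral>\<^sup>+\<theta>. (\<integral>\<^sup>+r. f (of_real r * cis \<theta>) * (ennreal r * indicator {0<..} r) \<partial>lborel)
          * indicator {0..2*pi} \<theta> \<partial>lborel)"
proof -
  define G where "G f \<theta> = (\<integral>\<^sup>+r. f (of_real r * cis \<theta>) * (ennreal r * indicator {0<..} r) \<partial>lborel)"
    for f :: "complex \<Rightarrow> ennreal" and \<theta>
  have [measurable]: "G f \<in> borel_measurable borel"
    unfolding G_def by measurable
  have "AE x in lborel. x \<noteq> (0::real)"
    by (rule AE_lborel_singleton)
  then have ae: "AE x in lborel. (\<integral>\<^sup>+y. f (Complex x y) \<partial>lborel)
      = (\<integral>\<^sup>+y. f (Complex x y) * indicator {z. 0 < Re z} (Complex x y)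
            + f (Complex x y) * indicator {z. 0 < Re z} (- Complex x y) \<partial>lborel)"
    by eventually_elim (auto intro!: nn_integral_cong simp: indicator_def)
  have "(\<integral>\<^sup>+z. f z \<partial>lborel)
    = (\<integral>\<^sup>+z. f z * indicator {z. 0 < Re z} z + f z * indicator {z. 0 < Re z} (- z) \<partial>lborel)"
    by (simp add: nn_integral_lborel_complex nn_integral_cong_AE[OF ae])
  also have "\<dots> = (\<integral>\<^sup>+z. f z * indicator {z. 0 < Re z} z \<partial>lborel)
      + (\<integral>\<^sup>+z. f z * indicator {z. 0 < Re z} (- z) \<partial>lborel)"
    by (intro nn_integral_add) measurable
  also have "(\<integral>\<^sup>+z. f z * indicator {z. 0 < Re z} (- z) \<partial>lborel)
      = (\<integral>\<^sup>+z. f (- z) * indicator {z. 0 < Re z} z \<partial>lborel)"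
    by (subst nn_integral_lborel_complex_uminus[symmetric]) auto
  also have "\<dots> = (\<integral>\<^sup>+\<theta>. G (\<lambda>z. f (- z)) \<theta> * indicator {-pi/2<..<pi/2} \<theta> \<partial>lborel)"
    unfolding G_def by (rule nn_integral_right_half_plane) measurable
  also have "\<dots> = (\<integral>\<^sup>+\<theta>. G f (pi + \<theta>) * indicator {-pi/2<..<pi/2} \<theta> \<partial>lborel)"
    by (simp add: G_def cis_mult[symmetric])
  also have "\<dots> = (\<integral>\<^sup>+\<theta>. G f \<theta> * indicator {pi/2<..<3*pi/2} \<theta> \<partial>lborel)"
    by (subst (2) nn_integral_real_affine[where c = 1 and t = pi])
       (auto intro!: nn_integral_cong simp: indicator_def)
  also have "(\<integral>\<^sup>+z. f z * indicator {z. 0 < Re z} z \<partial>lborel)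
      = (\<integral>\<^sup>+\<theta>. G f \<theta> * indicator {-pi/2<..<pi/2} \<theta> \<partial>lborel)"
    unfolding G_def by (rule nn_integral_right_half_plane) measurable
  also have "\<dots> = (\<integral>\<^sup>+\<theta>. G f \<theta> * indicator {-pi/2<..<0} \<theta> + G f \<theta> * indicator {0..<pi/2} \<theta> \<partial>lborel)"
    by (intro nn_integral_cong) (auto simp: indicator_def)
  also have "\<dots> = (\<integral>\<^sup>+\<theta>. G f \<theta> * indicator {-pi/2<..<0} \<theta> \<partial>lborel)
      + (\<integral>\<^sup>+\<theta>. G f \<theta> * indicator {0..<pi/2} \<theta> \<partial>lborel)"
    by (intro nn_integral_add) measurable
  also have "(\<integral>\<^sup>+\<theta>. G f \<theta> * indicator {-pi/2<..<0} \<theta> \<partial>lborel)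
      = (\<integral>\<^sup>+\<theta>. G f (2*pi + \<theta>) * indicator {3*pi/2<..<2*pi} (2*pi + \<theta>) \<partial>lborel)"
    by (intro nn_integral_cong) (auto simp: G_def cis_mult[symmetric] indicator_def)
  also have "\<dots> = (\<integral>\<^sup>+\<theta>. G f \<theta> * indicator {3*pi/2<..<2*pi} \<theta> \<partial>lborel)"
    by (subst (2) nn_integral_real_affine[where c = 1 and t = "2*pi"]) auto
  also have "(\<integral>\<^sup>+\<theta>. G f \<theta> * indicator {3*pi/2<..<2*pi} \<theta> \<partial>lborel)
      + (\<integral>\<^sup>+\<theta>. G f \<theta> * indicator {0..<pi/2} \<theta> \<partial>lborel)
      + (\<integral>\<^sup>+\<theta>. G f \<theta> * indicator {pi/2<..<3*pi/2} \<theta> \<partial>lborel)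
      = (\<integral>\<^sup>+\<theta>. G f \<theta> * indicator {3*pi/2<..<2*pi} \<theta> + G f \<theta> * indicator {0..<pi/2} \<theta>
            + G f \<theta> * indicator {pi/2<..<3*pi/2} \<theta> \<partial>lborel)"
    by (simp add: nn_integral_add)
  also have "\<dots> = (\<integral>\<^sup>+\<theta>. G f \<theta> * indicator {0..2*pi} \<theta> \<partial>lborel)"
  proof (rule nn_integral_cong_AE)
    have "AE \<theta> in lborel. \<theta> \<noteq> pi/2" "AE \<theta> in lborel. \<theta> \<noteq> 3*pi/2" "AE \<theta> in lborel. \<theta> \<noteq> 2*pi"
      by (rule AE_lborel_singleton)+
    then show "AE \<theta> in lborel. G f \<theta> * indicator {3*pi/2<..<2*pi} \<theta> + G f \<theta> * indicator {0..<pi/2} \<theta>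
            + G f \<theta> * indicator {pi/2<..<3*pi/2} \<theta> = G f \<theta> * indicator {0..2*pi} \<theta>"
      by eventually_elim (auto simp: indicator_def)
  qed
  finally show ?thesis unfolding G_def .
qed

section \<open>The gamma distribution\<close>

text \<open>The gamma distribution with shape \<open>s\<close> and rate \<open>1\<close>; meaningful for \<open>s > 0\<close>.\<close>

definition gamma_distribution :: "real \<Rightarrow> real measure" where
  "gamma_distribution s =
     density lborel (\<lambda>t. ennreal (t powr (s - 1) * exp (- t) / Gamma s) * indicator {0<..} t)"

lemma sets_gamma_distribution [simp, measurable_cong]: "sets (gamma_distribution s) = sets borel"
  by (simp add: gamma_distribution_def)

lemma space_gamma_distribution [simp]: "space (gamma_distribution s) = UNIV"
  by (simp add: gamma_distribution_def)

lemma nn_integral_gamma_distribution_power: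
  assumes s: "0 < s"
  shows "(\<integral>\<^sup>+t. ennreal (t ^ j) \<partial>gamma_distribution s) = ennreal (Gamma (s + real j) / Gamma s)"
proof -
  have "(\<integral>\<^sup>+t. ennreal (t ^ j) \<partial>gamma_distribution s)
      = (\<integral>\<^sup>+t. ennreal (t powr (s - 1) * exp (- t) / Gamma s) * indicator {0<..} t * ennreal (t ^ j) \<partial>lborel)"
    unfolding gamma_distribution_def by (rule nn_integral_density) measurable
  also have "\<dots> = (\<integral>\<^sup>+t. ennreal (1 / Gamma s)
      * ennreal (indicator {0..} t * t powr (s + real j - 1) / exp t) \<partial>lborel)"
  proof (rule nn_integral_cong)
    fix t :: real
    have "Gamma s > 0" using s by (rule Gamma_real_pos)
    moreover have "t powr (s - 1) * t ^ j = t powr (s + real j - 1)" if "t > 0"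
      using that by (simp add: powr_realpow[symmetric] powr_add[symmetric] algebra_simps)
    ultimately show "ennreal (t powr (s - 1) * exp (- t) / Gamma s) * indicator {0<..} t * ennreal (t ^ j)
      = ennreal (1 / Gamma s) * ennreal (indicator {0..} t * t powr (s + real j - 1) / exp t)"
      by (cases "t > 0"; cases "t = 0") (auto simp: ennreal_mult[symmetric] exp_minus divide_simps indicator_def
          simp flip: mult.assoc)
  qed
  also have "\<dots> = ennreal (1 / Gamma s) * ennreal (Gamma (s + real j))"
    using s by (subst nn_integral_cmult) (auto simp: Gamma_conv_nn_integral_real)
  also have "\<dots> = ennreal (Gamma (s + real j) / Gamma s)"
    using s by (simp add: ennreal_mult[symmetric] Gamma_real_pos less_imp_le)
  finally show ?thesis .
qed

lemma AE_gamma_distribution_pos: "AE t in gamma_distribution s. 0 < t"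
  unfolding gamma_distribution_def by (subst AE_density) (auto simp: indicator_def)

lemma prob_space_gamma_distribution:
  assumes "0 < s"
  shows "prob_space (gamma_distribution s)"
proof
  show "emeasure (gamma_distribution s) (space (gamma_distribution s)) = 1"
    using nn_integral_gamma_distribution_power[OF assms, of 0] Gamma_real_pos[OF assms] by simp
qed

lemma has_bochner_integral_gamma_distribution_power:
  assumes "0 < s"
  shows "has_bochner_integral (gamma_distribution s) (\<lambda>t. t ^ j) (Gamma (s + real j) / Gamma s)"
proof (rule has_bochner_integral_nn_integral)
  show "AE t in gamma_distribution s. 0 \<le> t ^ j"
    using AE_gamma_distribution_pos by eventually_elim simp
  show "0 \<le> Gamma (s + real j) / Gamma s"
    using assms by (simp add: Gamma_real_pos less_imp_le)
qed (use nn_integral_gamma_distribution_power[OF assms] in auto)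

text \<open>The gamma distribution with shape \<open>s\<close> has mean \<open>s\<close>, so this is its variance, which is also \<open>s\<close>.\<close>
lemma gamma_distribution_variance:
  assumes s: "0 < s"
  shows "has_bochner_integral (gamma_distribution s) (\<lambda>t. (t - s)\<^sup>2) s"
proof -
  note m = has_bochner_integral_gamma_distribution_power[OF s]
  have g: "Gamma s \<noteq> 0" using Gamma_real_pos[OF s] by simp
  have g1: "Gamma (s + 1) = s * Gamma s" 
    using s by (intro Gamma_plus1) (auto elim!: nonpos_Ints_cases)
  have g2: "Gamma (s + 2) = (s + 1) * (s * Gamma s)"
  proof -
    have "Gamma (s + 1 + 1) = (s + 1) * Gamma (s + 1)"
      using s by (intro Gamma_plus1) (auto elim!: nonpos_Ints_cases)
    then show ?thesis by (simp add: g1 add.assoc)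
  qed
  have "has_bochner_integral (gamma_distribution s) (\<lambda>t. t ^ 2 - 2 * s * t ^ 1 + s\<^sup>2 * t ^ 0)
     (Gamma (s + real 2) / Gamma s - 2 * s * (Gamma (s + real 1) / Gamma s)
        + s\<^sup>2 * (Gamma (s + real 0) / Gamma s))"
    by (intro has_bochner_integral_add has_bochner_integral_diff has_bochner_integral_mult_right m)
  also have "(\<lambda>t. t ^ 2 - 2 * s * t ^ 1 + s\<^sup>2 * t ^ 0) = (\<lambda>t. (t - s)\<^sup>2)"
    by (simp add: power2_eq_square algebra_simps)
  also have "Gamma (s + real 2) / Gamma s - 2 * s * (Gamma (s + real 1) / Gamma s)
        + s\<^sup>2 * (Gamma (s + real 0) / Gamma s) = s"
  proof -
    have "Gamma (s + real 2) / Gamma s = (s + 1) * s" "Gamma (s + real 1) / Gamma s = s"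
        "Gamma (s + real 0) / Gamma s = 1"
      using g by (simp_all add: g1 g2)
    then show ?thesis by (simp add: power2_eq_square algebra_simps)
  qed
  finally show ?thesis .
qed

section \<open>Radial measures on the plane\<close>

text \<open>The uniform distribution of an angle on \<open>[0, 2\<pi>]\<close>.\<close>

definition uniform_angle :: "real measure" where
  "uniform_angle = uniform_measure lborel {0..2*pi}"

text \<open>The point of the plane with argument \<open>\<theta>\<close> and \<open>|z|\<^sup>p = t\<close>, for \<open>p > 0\<close> and
  \<open>t > 0\<close>; it is \<open>0\<close> when \<open>t = 0\<close>.\<close>

definition powr_polar :: "real \<Rightarrow> real \<times> real \<Rightarrow> complex" where
  "powr_polar p = (\<lambda>(t, \<theta>). of_real (t powr (1/p)) * cis \<theta>)"

text \<open>The contribution of the index \<open>k\<close> to the kernel on the diagonal: the squared modulus of the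
  \<open>k\<close>-th normalised monomial times the weight \<open>exp (- |z|\<^sup>p)\<close>.  For \<open>p > 0\<close> its total
  mass is \<open>1\<close>.\<close>

definition radial_density :: "real \<Rightarrow> nat \<Rightarrow> complex \<Rightarrow> real" where
  "radial_density p k z =
     p / (2*pi) * norm z ^ (2*k) / Gamma (2/p * (real k + 1)) * exp (- (norm z powr p))"

lemma sets_uniform_angle [simp, measurable_cong]: "sets uniform_angle = sets borel"
  by (simp add: uniform_angle_def)

lemma space_uniform_angle [simp]: "space uniform_angle = UNIV"
  by (simp add: uniform_angle_def)

lemma prob_space_uniform_angle: "prob_space uniform_angle"
  unfolding uniform_angle_def by (intro prob_space_uniform_measure) auto

lemma measurable_powr_polar [measurable]: "powr_polar p \<in> borel_measurable (borel \<Otimes>\<^sub>M borel)"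
  unfolding powr_polar_def by measurable

lemma nn_integral_powr_polar:
  assumes [measurable]: "w \<in> borel_measurable borel" "f \<in> borel_measurable borel"
  shows "(\<integral>\<^sup>+z. f z \<partial>distr (density lborel w \<Otimes>\<^sub>M uniform_angle) borel (powr_polar p))
    = (\<integral>\<^sup>+\<theta>. (\<integral>\<^sup>+t. w t * f (powr_polar p (t, \<theta>)) \<partial>lborel) / ennreal (2*pi)
        * indicator {0..2*pi} \<theta> \<partial>lborel)"
proof -
  interpret U: prob_space uniform_angle by (rule prob_space_uniform_angle)
  have [measurable]: "(\<lambda>(\<theta>, t). w t * f (powr_polar p (t, \<theta>))) \<in> borel_measurable (borel \<Otimes>\<^sub>M lborel)"
    by measurable
  have "(\<integral>\<^sup>+z. f z \<partial>distr (density lborel w \<Otimes>\<^sub>M uniform_angle) borel (powr_polar p))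
      = (\<integral>\<^sup>+t. \<integral>\<^sup>+\<theta>. f (powr_polar p (t, \<theta>)) \<partial>uniform_angle \<partial>density lborel w)"
    by (subst nn_integral_distr) (auto simp: U.nn_integral_fst[symmetric])
  also have "\<dots> = (\<integral>\<^sup>+t. w t * (\<integral>\<^sup>+\<theta>. f (powr_polar p (t, \<theta>)) \<partial>uniform_angle) \<partial>lborel)"
    by (subst nn_integral_density) auto
  also have "\<dots> = (\<integral>\<^sup>+t. (\<integral>\<^sup>+\<theta>. w t * f (powr_polar p (t, \<theta>)) / ennreal (2*pi)
        * indicator {0..2*pi} \<theta> \<partial>lborel) \<partial>lborel)"
    unfolding uniform_angle_def
    by (subst nn_integral_uniform_measure)
       (auto simp: nn_integral_cmult[symmetric] divide_ennreal_def mult_ac intro!: nn_integral_cong)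
  also have "\<dots> = (\<integral>\<^sup>+\<theta>. (\<integral>\<^sup>+t. w t * f (powr_polar p (t, \<theta>)) / ennreal (2*pi)
        * indicator {0..2*pi} \<theta> \<partial>lborel) \<partial>lborel)"
    by (rule lborel_pair.Fubini') measurable
  also have "\<dots> = (\<integral>\<^sup>+\<theta>. (\<integral>\<^sup>+t. w t * f (powr_polar p (t, \<theta>)) \<partial>lborel) / ennreal (2*pi)
        * indicator {0..2*pi} \<theta> \<partial>lborel)"
    by (simp add: divide_ennreal_def nn_integral_multc)
  finally show ?thesis .
qed

text \<open>A radial measure is the law of a random \<open>t = |z|\<^sup>p\<close> with an independent uniform angle.  The
  Jacobian: \<open>r = t powr (1/p)\<close> gives \<open>r dr = (1/p) t powr (2/p - 1) dt\<close>, and \<open>2\<pi>\<close> compensates for the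
  normalisation of the angle.\<close>
lemma density_radial_eq_distr_powr_polar:
  fixes g w :: "real \<Rightarrow> ennreal"
  assumes [measurable]: "w \<in> borel_measurable borel" "g \<in> borel_measurable borel" and p: "0 < p"
    and w: "\<And>t. w t = ennreal (2*pi/p * t powr (2/p - 1)) * g t * indicator {0<..} t"
  shows "density lborel (\<lambda>z::complex. g (norm z powr p))
    = distr (density lborel w \<Otimes>\<^sub>M uniform_angle) borel (powr_polar p)"
proof (rule measure_eqI)
  fix A :: "complex set" assume "A \<in> sets (density lborel (\<lambda>z. g (norm z powr p)))"
  then have [measurable]: "A \<in> sets borel" by simp
  have "emeasure (density lborel (\<lambda>z. g (norm z powr p))) A
      = (\<integral>\<^sup>+z. g (norm z powr p) * indicator A z \<partial>lborel)"
    by (rule emeasure_density) auto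
  also have "\<dots> = (\<integral>\<^sup>+\<theta>. (\<integral>\<^sup>+r. g (norm (of_real r * cis \<theta>) powr p) * indicator A (of_real r * cis \<theta>)
      * (ennreal r * indicator {0<..} r) \<partial>lborel) * indicator {0..2*pi} \<theta> \<partial>lborel)"
    by (rule nn_integral_lborel_polar) measurable
  also have "\<dots> = (\<integral>\<^sup>+\<theta>. (\<integral>\<^sup>+t. w t * indicator A (powr_polar p (t, \<theta>)) \<partial>lborel) / ennreal (2*pi)
        * indicator {0..2*pi} \<theta> \<partial>lborel)"
  proof (rule nn_integral_cong)
    fix \<theta> :: real
    have "(\<integral>\<^sup>+r. g (norm (of_real r * cis \<theta>) powr p) * indicator A (of_real r * cis \<theta>)
        * (ennreal r * indicator {0<..} r) \<partial>lborel)
      = (\<integral>\<^sup>+r. (g (\<bar>r\<bar> powr p) * indicator A (of_real r * cis \<theta>) * ennreal r) * indicator {0<..} r \<partial>lborel)"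
      by (simp add: norm_mult mult_ac)
    also have "\<dots> = (\<integral>\<^sup>+t. (g (\<bar>t powr (1/p)\<bar> powr p) * indicator A (of_real (t powr (1/p)) * cis \<theta>)
        * ennreal (t powr (1/p))) * (1/p * t powr (1/p - 1)) * indicator {0<..} t \<partial>lborel)"
      using p by (subst nn_integral_substitution_powr[of _ "1/p"]) auto
    also have "\<dots> = (\<integral>\<^sup>+t. w t * indicator A (powr_polar p (t, \<theta>)) / ennreal (2*pi) \<partial>lborel)"
    proof (rule nn_integral_cong)
      fix t :: real
      show "g (\<bar>t powr (1/p)\<bar> powr p) * indicator A (of_real (t powr (1/p)) * cis \<theta>)
        * ennreal (t powr (1/p)) * (1/p * t powr (1/p - 1)) * indicator {0<..} t
        = w t * indicator A (powr_polar p (t, \<theta>)) / ennreal (2*pi)"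
      proof (cases "t > 0")
        case True
        have "t powr (1/p) * (1/p * t powr (1/p - 1)) = 2*pi/p * t powr (2/p - 1) * inverse (2*pi)"
          by (simp add: powr_add[symmetric] field_simps)
        then have "ennreal (t powr (1/p)) * ennreal (1/p * t powr (1/p - 1))
            = ennreal (2*pi/p * t powr (2/p - 1)) * inverse (ennreal (2*pi))"
          using p by (simp add: inverse_ennreal ennreal_mult[symmetric])
        note c = this
        have "\<bar>t powr (1/p)\<bar> powr p = t"
          using True p by (simp add: powr_powr)
        then have "g (\<bar>t powr (1/p)\<bar> powr p) * indicator A (of_real (t powr (1/p)) * cis \<theta>)
            * ennreal (t powr (1/p)) * (1/p * t powr (1/p - 1)) * indicator {0<..} t
          = g t * indicator A (powr_polar p (t, \<theta>))
              * (ennreal (t powr (1/p)) * ennreal (1/p * t powr (1/p - 1)))"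
          using True by (simp add: powr_polar_def mult_ac)
        also have "\<dots> = w t * indicator A (powr_polar p (t, \<theta>)) / ennreal (2*pi)"
          unfolding c using True by (simp add: w divide_ennreal_def mult_ac)
        finally show ?thesis .
      qed (simp add: w)
    qed
    also have "\<dots> = (\<integral>\<^sup>+t. w t * indicator A (powr_polar p (t, \<theta>)) \<partial>lborel) / ennreal (2*pi)"
      by (simp add: nn_integral_divide)
    finally show "(\<integral>\<^sup>+r. g (norm (of_real r * cis \<theta>) powr p) * indicator A (of_real r * cis \<theta>)
        * (ennreal r * indicator {0<..} r) \<partial>lborel) * indicator {0..2*pi} \<theta>
      = (\<integral>\<^sup>+t. w t * indicator A (powr_polar p (t, \<theta>)) \<partial>lborel) / ennreal (2*pi)
        * indicator {0..2*pi} \<theta>" by simp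
  qed
  also have "\<dots> = (\<integral>\<^sup>+z. indicator A z \<partial>distr (density lborel w \<Otimes>\<^sub>M uniform_angle) borel (powr_polar p))"
    by (rule nn_integral_powr_polar[symmetric]) measurable
  also have "\<dots> = emeasure (distr (density lborel w \<Otimes>\<^sub>M uniform_angle) borel (powr_polar p)) A"
    by simp
  finally show "emeasure (density lborel (\<lambda>z. g (norm z powr p))) A
    = emeasure (distr (density lborel w \<Otimes>\<^sub>M uniform_angle) borel (powr_polar p)) A" .
qed simp

text \<open>Under the \<open>k\<close>-th radial density, \<open>|z|\<^sup>p\<close> has the gamma distribution with shape
  \<open>2 (k + 1) / p\<close>.\<close>
lemma density_radial_density:
  assumes p: "0 < p"
  shows "density lborel (\<lambda>z. ennreal (radial_density p k z))
    = distr (gamma_distribution (2/p * (real k + 1)) \<Otimes>\<^sub>M uniform_angle) borel (powr_polar p)"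
proof -
  define s where "s = 2/p * (real k + 1)"
  have "s > 0" using p by (simp add: s_def)
  then have G: "Gamma s > 0" by (rule Gamma_real_pos)
  define g where "g u = ennreal (p / (2*pi) * (u powr (1/p)) ^ (2*k) / Gamma s * exp (- u))" for u
  have "radial_density p k z = p / (2*pi) * ((norm z powr p) powr (1/p)) ^ (2*k) / Gamma s
      * exp (- (norm z powr p))" for z
    using p by (simp add: radial_density_def s_def powr_powr)
  then have "density lborel (\<lambda>z. ennreal (radial_density p k z)) = density lborel (\<lambda>z. g (norm z powr p))"
    by (simp add: g_def)
  also have "\<dots> = distr (density lborel (\<lambda>t. ennreal (t powr (s - 1) * exp (- t) / Gamma s)
      * indicator {0<..} t) \<Otimes>\<^sub>M uniform_angle) borel (powr_polar p)"
  proof (rule density_radial_eq_distr_powr_polar[OF _ _ p])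
    fix t :: real
    show "ennreal (t powr (s - 1) * exp (- t) / Gamma s) * indicator {0<..} t
        = ennreal (2*pi/p * t powr (2/p - 1)) * g t * indicator {0<..} t"
    proof (cases "t > 0")
      case True
      have "(t powr (1/p)) ^ (2*k) = t powr (2/p * real k)"
        using True by (simp add: powr_realpow[symmetric] powr_powr)
      moreover have "t powr (s - 1) = t powr (2/p - 1) * t powr (2/p * real k)"
      proof -
        have "s - 1 = (2/p - 1) + 2/p * real k" by (simp add: s_def algebra_simps add_divide_distrib)
        then show ?thesis by (simp only: powr_add)
      qed
      ultimately have "t powr (s - 1) * exp (- t) / Gamma s
        = 2*pi/p * t powr (2/p - 1) * (p / (2*pi) * (t powr (1/p)) ^ (2*k) / Gamma s * exp (- t))"
        using p by (simp add: field_simps)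
      moreover have "0 \<le> p / (2*pi) * (t powr (1/p)) ^ (2*k) / Gamma s * exp (- t)"
        using p G by simp
      ultimately show ?thesis
        using p by (simp only: g_def ennreal_mult[symmetric] powr_ge_zero) (simp add: ennreal_mult[symmetric])
    qed simp
  qed (auto simp: g_def[abs_def])
  finally show ?thesis unfolding gamma_distribution_def s_def .
qed

text \<open>Under the limit measure, \<open>|z|\<^sup>p\<close> is uniform on \<open>(0, 2/p)\<close>: the density
  \<open>p\<^sup>2 / (4\<pi>) r powr (p - 1) dr d\<theta>\<close> becomes \<open>(p/2) dt\<close> times the uniform angle,
  because \<open>dr = (1/p) t powr (1/p - 1) dt\<close> cancels the power of \<open>r = t powr (1/p)\<close>.\<close>
lemma limit_measure_eq_distr_powr_polar:
  assumes p: "0 < p"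
  shows "limit_measure p
    = distr (uniform_measure lborel {0<..<2/p} \<Otimes>\<^sub>M uniform_angle) borel (powr_polar p)"
proof (rule measure_eqI)
  fix A :: "complex set" assume "A \<in> sets (limit_measure p)"
  then have [measurable]: "A \<in> sets borel" by (simp add: limit_measure_def)
  define R where "R = (2/p) powr (1/p)"
  define d where "d r = ennreal (p\<^sup>2 / (4*pi) * r powr (p - 1)) * indicator {0<..<R} r" for r
  have [measurable]: "d \<in> borel_measurable borel" unfolding d_def by measurable
  have lim: "limit_measure p = distr (density (lborel \<Otimes>\<^sub>M lborel) (\<lambda>(r, \<theta>). d r * indicator {0..2*pi} \<theta>))
      borel (\<lambda>(r, \<theta>). of_real r * cis \<theta>)"
    unfolding limit_measure_def lborel_prod R_def[symmetric]
    by (intro distr_cong density_cong arg_cong2[where f = "\<lambda>M f. distr M borel f"] arg_cong2[where f = density])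
       (auto simp: d_def indicator_def fun_eq_iff)
  have "emeasure (limit_measure p) A = (\<integral>\<^sup>+z. indicator A z \<partial>limit_measure p)"
    by (simp add: lim)
  also have "\<dots> = (\<integral>\<^sup>+x. (case x of (r, \<theta>) \<Rightarrow> d r * indicator {0..2*pi} \<theta>)
      * indicator A (case x of (r, \<theta>) \<Rightarrow> of_real r * cis \<theta>) \<partial>(lborel \<Otimes>\<^sub>M lborel))"
    unfolding lim by (subst nn_integral_distr, simp, simp, subst nn_integral_density) simp_all
  also have "\<dots> = (\<integral>\<^sup>+\<theta>. \<integral>\<^sup>+r. d r * indicator {0..2*pi} \<theta> * indicator A (of_real r * cis \<theta>) \<partial>lborel \<partial>lborel)"
    by (subst lborel_pair.nn_integral_snd[symmetric]) simp_all
  also have "\<dots> = (\<integral>\<^sup>+\<theta>. (\<integral>\<^sup>+t. (indicator {0<..<2/p} t / ennreal (2/p)) * indicator A (powr_polar p (t, \<theta>)) \<partial>lborel) / ennreal (2*pi)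
        * indicator {0..2*pi} \<theta> \<partial>lborel)"
  proof (rule nn_integral_cong)
    fix \<theta> :: real
    have "(\<integral>\<^sup>+r. d r * indicator {0..2*pi} \<theta> * indicator A (of_real r * cis \<theta>) \<partial>lborel)
      = (\<integral>\<^sup>+r. d r * indicator A (of_real r * cis \<theta>) * indicator {0<..} r * indicator {0..2*pi} \<theta> \<partial>lborel)"
      by (intro nn_integral_cong) (auto simp: d_def indicator_def)
    also have "\<dots> = (\<integral>\<^sup>+r. d r * indicator A (of_real r * cis \<theta>) * indicator {0<..} r \<partial>lborel) * indicator {0..2*pi} \<theta>"
      by (rule nn_integral_multc) measurable
    also have "(\<integral>\<^sup>+r. d r * indicator A (of_real r * cis \<theta>) * indicator {0<..} r \<partial>lborel)
      = (\<integral>\<^sup>+t. (d (t powr (1/p)) * indicator A (of_real (t powr (1/p)) * cis \<theta>))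
          * (1/p * t powr (1/p - 1)) * indicator {0<..} t \<partial>lborel)"
      using p by (subst nn_integral_substitution_powr[of _ "1/p"]) auto
    also have "\<dots> = (\<integral>\<^sup>+t. (indicator {0<..<2/p} t / ennreal (2/p)) * indicator A (powr_polar p (t, \<theta>)) / ennreal (2*pi) \<partial>lborel)"
    proof (rule nn_integral_cong)
      fix t :: real
      show "d (t powr (1/p)) * indicator A (of_real (t powr (1/p)) * cis \<theta>)
          * (1/p * t powr (1/p - 1)) * indicator {0<..} t
        = (indicator {0<..<2/p} t / ennreal (2/p)) * indicator A (powr_polar p (t, \<theta>)) / ennreal (2*pi)"
      proof (cases "t > 0")
        case True
        have "t powr (1/p) < R \<longleftrightarrow> t < 2/p"
        proof
          assume "t powr (1/p) < R"
          then have "(t powr (1/p)) powr p < R powr p"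
            using p by (intro powr_less_mono2) auto
          then show "t < 2/p" using True p by (simp add: R_def powr_powr)
        next
          assume "t < 2/p"
          then show "t powr (1/p) < R" using True p by (auto simp: R_def intro!: powr_less_mono2)
        qed
        then have ind: "indicator {0<..<R} (t powr (1/p)) = (indicator {0<..<2/p} t :: ennreal)"
          using True by (auto simp: indicator_def)
        have "t powr (1 - 1/p) * t powr (1/p - 1) = 1"
          using True by (simp add: powr_add[symmetric])
        moreover have "(t powr (1/p)) powr (p - 1) = t powr (1 - 1/p)"
          using p by (simp add: powr_powr field_simps)
        ultimately have "p\<^sup>2 / (4*pi) * (t powr (1/p)) powr (p - 1) * (1/p * t powr (1/p - 1))
            = inverse (2/p) * inverse (2*pi)"
          using p by (simp add: field_simps power2_eq_square)
        then have "ennreal (p\<^sup>2 / (4*pi) * (t powr (1/p)) powr (p - 1) * (1/p * t powr (1/p - 1)))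
            = ennreal (inverse (2/p) * inverse (2*pi))"
          by (simp only:)
        also have "\<dots> = inverse (ennreal (2/p)) * inverse (ennreal (2*pi))"
          using p by (subst ennreal_mult) (auto simp: inverse_ennreal)
        also have "ennreal (p\<^sup>2 / (4*pi) * (t powr (1/p)) powr (p - 1) * (1/p * t powr (1/p - 1)))
            = ennreal (p\<^sup>2 / (4*pi) * (t powr (1/p)) powr (p - 1)) * ennreal (1/p * t powr (1/p - 1))"
          using p by (intro ennreal_mult) auto
        finally have c: "ennreal (p\<^sup>2 / (4*pi) * (t powr (1/p)) powr (p - 1)) * ennreal (1/p * t powr (1/p - 1))
            = inverse (ennreal (2/p)) * inverse (ennreal (2*pi))" .
        have "d (t powr (1/p)) * indicator A (of_real (t powr (1/p)) * cis \<theta>)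
            * (1/p * t powr (1/p - 1)) * indicator {0<..} t
          = indicator {0<..<2/p} t * indicator A (powr_polar p (t, \<theta>))
            * (ennreal (p\<^sup>2 / (4*pi) * (t powr (1/p)) powr (p - 1)) * ennreal (1/p * t powr (1/p - 1)))"
          using True by (simp add: d_def ind powr_polar_def mult_ac)
        also have "\<dots> = (indicator {0<..<2/p} t / ennreal (2/p)) * indicator A (powr_polar p (t, \<theta>)) / ennreal (2*pi)"
          unfolding c by (simp add: divide_ennreal_def mult_ac)
        finally show ?thesis .
      qed simp
    qed
    also have "\<dots> = (\<integral>\<^sup>+t. (indicator {0<..<2/p} t / ennreal (2/p)) * indicator A (powr_polar p (t, \<theta>)) \<partial>lborel) / ennreal (2*pi)"
      by (rule nn_integral_divide) measurable
    finally show "(\<integral>\<^sup>+r. d r * indicator {0..2*pi} \<theta> * indicator A (of_real r * cis \<theta>) \<partial>lborel)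
      = (\<integral>\<^sup>+t. (indicator {0<..<2/p} t / ennreal (2/p)) * indicator A (powr_polar p (t, \<theta>)) \<partial>lborel) / ennreal (2*pi)
        * indicator {0..2*pi} \<theta>" .
  qed
  also have "\<dots> = (\<integral>\<^sup>+z. indicator A z
      \<partial>distr (density lborel (\<lambda>t. indicator {0<..<2/p} t / ennreal (2/p)) \<Otimes>\<^sub>M uniform_angle) borel (powr_polar p))"
    by (rule nn_integral_powr_polar[symmetric]) measurable
  also have "density lborel (\<lambda>t. indicator {0<..<2/p} t / ennreal (2/p)) = uniform_measure lborel {0<..<2/p}"
    using p by (simp add: uniform_measure_def)
  also have "(\<integral>\<^sup>+z. indicator A z \<partial>distr (uniform_measure lborel {0<..<2/p} \<Otimes>\<^sub>M uniform_angle) borel (powr_polar p))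
      = emeasure (distr (uniform_measure lborel {0<..<2/p} \<Otimes>\<^sub>M uniform_angle) borel (powr_polar p)) A"
    by simp
  finally show "emeasure (limit_measure p) A
    = emeasure (distr (uniform_measure lborel {0<..<2/p} \<Otimes>\<^sub>M uniform_angle) borel (powr_polar p)) A" .
qed (simp add: limit_measure_def)

section \<open>Averages of gamma expectations\<close>

text \<open>Near \<open>s\<close> uniform continuity on the compact interval applies, and away from \<open>s\<close> the quadratic
  term absorbs the bound on \<open>F\<close>.  Integrated against a probability measure with mean \<open>s\<close>, the
  inequality is Chebyshev's argument: the error is at most \<open>e\<close> plus \<open>C\<close> times the variance.\<close>
lemma quadratic_modulus_of_continuity:
  fixes F :: "real \<Rightarrow> real"
  assumes cont: "continuous_on {0..} F" and bound: "\<And>t. \<bar>F t\<bar> \<le> B" and e: "0 < e"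
  obtains C where "0 \<le> C" and "\<And>s t. 0 \<le> s \<Longrightarrow> s \<le> a \<Longrightarrow> 0 \<le> t \<Longrightarrow> \<bar>F t - F s\<bar> \<le> e + C * (t - s)\<^sup>2"
proof -
  have B: "0 \<le> B" using bound[of 0] by linarith
  have "uniformly_continuous_on {0..a + 1} F"
    by (intro compact_uniformly_continuous continuous_on_subset[OF cont]) auto
  then obtain d where d: "0 < d"
      "\<And>s t. s \<in> {0..a + 1} \<Longrightarrow> t \<in> {0..a + 1} \<Longrightarrow> \<bar>t - s\<bar> < d \<Longrightarrow> \<bar>F t - F s\<bar> < e"
    using e unfolding uniformly_continuous_on_def dist_real_def by metis
  define \<delta> where "\<delta> = min d 1"
  have \<delta>: "0 < \<delta>" "\<delta> \<le> d" "\<delta> \<le> 1" using d by (auto simp: \<delta>_def)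
  show thesis
  proof (rule that[of "2 * B / \<delta>\<^sup>2"])
    fix s t :: real assume st: "0 \<le> s" "s \<le> a" "0 \<le> t"
    show "\<bar>F t - F s\<bar> \<le> e + 2 * B / \<delta>\<^sup>2 * (t - s)\<^sup>2"
    proof (cases "\<bar>t - s\<bar> < \<delta>")
      case True
      then have "\<bar>F t - F s\<bar> < e" using st \<delta> by (intro d(2)) auto
      moreover have "0 \<le> 2 * B / \<delta>\<^sup>2 * (t - s)\<^sup>2" using B by simp
      ultimately show ?thesis by linarith
    next
      case False
      then have "\<delta>\<^sup>2 \<le> \<bar>t - s\<bar>\<^sup>2" using \<delta> by (intro power_mono) auto
      then have "1 \<le> (t - s)\<^sup>2 / \<delta>\<^sup>2" using \<delta> by simp
      then have "2 * B * 1 \<le> 2 * B * ((t - s)\<^sup>2 / \<delta>\<^sup>2)" using B by (intro mult_left_mono) auto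
      moreover have "\<bar>F t - F s\<bar> \<le> 2 * B" using bound[of t] bound[of s] by linarith
      ultimately show ?thesis using e by simp
    qed
  qed (use B in simp)
qed

lemma gamma_distribution_expectation_bound:
  fixes F :: "real \<Rightarrow> real"
  assumes [measurable]: "F \<in> borel_measurable borel" and bound: "\<And>t. \<bar>F t\<bar> \<le> B"
    and s: "0 < s" and n: "0 < n"
    and C: "\<And>t. 0 \<le> t \<Longrightarrow> \<bar>F t - F (s / n)\<bar> \<le> e + C * (t - s / n)\<^sup>2"
  shows "\<bar>(\<integral>t. F (t / n) \<partial>gamma_distribution s) - F (s / n)\<bar> \<le> e + C * s / n\<^sup>2"
proof -
  interpret G: prob_space "gamma_distribution s" by (rule prob_space_gamma_distribution[OF s])
  have v: "integrable (gamma_distribution s) (\<lambda>t. (t - s)\<^sup>2)"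
      "(\<integral>t. (t - s)\<^sup>2 \<partial>gamma_distribution s) = s"
    using gamma_distribution_variance[OF s] by (auto simp: has_bochner_integral_iff)
  have i: "integrable (gamma_distribution s) (\<lambda>t. F (t / n))"
    by (rule G.integrable_const_bound[where B = B]) (use bound in auto)
  have "\<bar>(\<integral>t. F (t / n) \<partial>gamma_distribution s) - F (s / n)\<bar>
      = \<bar>\<integral>t. F (t / n) - F (s / n) \<partial>gamma_distribution s\<bar>"
    using i G.prob_space by simp
  also have "\<dots> \<le> (\<integral>t. \<bar>F (t / n) - F (s / n)\<bar> \<partial>gamma_distribution s)"
    by (rule integral_abs_bound)
  also have "\<dots> \<le> (\<integral>t. e + C / n\<^sup>2 * (t - s)\<^sup>2 \<partial>gamma_distribution s)"
  proof (rule integral_mono_AE)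
    show "AE t in gamma_distribution s. \<bar>F (t / n) - F (s / n)\<bar> \<le> e + C / n\<^sup>2 * (t - s)\<^sup>2"
      using AE_gamma_distribution_pos
    proof eventually_elim
      case (elim t)
      have "(t / n - s / n)\<^sup>2 = (t - s)\<^sup>2 / n\<^sup>2"
        by (simp add: diff_divide_distrib[symmetric] power_divide)
      then show ?case using C[of "t / n"] elim n by simp
    qed
  qed (use i v in auto)
  also have "\<dots> = e + C * s / n\<^sup>2"
    using v G.prob_space by simp
  finally show ?thesis .
qed

lemma riemann_cell_bound:
  fixes F :: "real \<Rightarrow> real"
  assumes cont: "continuous_on {x..x + h} F" and h: "0 < h" and "0 \<le> C"
    and C: "\<And>t. x \<le> t \<Longrightarrow> t \<le> x + h \<Longrightarrow> \<bar>F t - F (x + h)\<bar> \<le> e + C * (t - (x + h))\<^sup>2"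
  shows "\<bar>h * F (x + h) - integral {x..x + h} F\<bar> \<le> h * (e + C * h\<^sup>2)"
proof -
  have i: "F integrable_on {x..x + h}"
    by (rule integrable_continuous_interval[OF cont])
  have "integral {x..x + h} F - h * F (x + h) = integral {x..x + h} (\<lambda>t. F t - F (x + h))"
    using h i by (subst integral_diff) auto
  also have "norm \<dots> \<le> (e + C * h\<^sup>2) * (x + h - x)"
  proof (rule integral_bound)
    fix t assume t: "t \<in> {x..x + h}"
    then have "(t - (x + h))\<^sup>2 \<le> h\<^sup>2" 
      by (intro abs_le_square_iff[THEN iffD1]) auto
    then have "C * (t - (x + h))\<^sup>2 \<le> C * h\<^sup>2" using \<open>0 \<le> C\<close> by (rule mult_left_mono)
    then show "norm (F t - F (x + h)) \<le> e + C * h\<^sup>2"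
      using C[of t] t by auto
  qed (use h in \<open>auto intro!: continuous_intros cont\<close>)
  finally show ?thesis by (simp add: abs_minus_commute mult.commute)
qed

lemma integral_sum_cells:
  fixes F :: "real \<Rightarrow> real"
  assumes cont: "continuous_on {0..} F" and h: "0 < h"
  shows "(\<Sum>k<n. integral {h * real k..h * real k + h} F) = integral {0..h * real n} F"
proof (induction n)
  case (Suc n)
  have "integral {0..h * real n} F + integral {h * real n..h * real n + h} F
      = integral {0..h * real n + h} F"
    using h
    by (intro Henstock_Kurzweil_Integration.integral_combine integrable_continuous_interval continuous_on_subset[OF cont]) auto
  then show ?case using Suc by (simp add: algebra_simps)
qed simp

text \<open>If \<open>T\<^sub>k\<close> is gamma distributed with shape \<open>a (k + 1)\<close>, then \<open>T\<^sub>k / n\<close> has mean \<open>a (k + 1) / n\<close> and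
  variance at most \<open>a / n\<close> for \<open>k < n\<close>, so the average of the expectations of \<open>F (T\<^sub>k / n)\<close> behaves
  like a Riemann sum of \<open>F\<close> over \<open>[0, a]\<close>.\<close>
lemma gamma_average_tendsto:
  fixes F :: "real \<Rightarrow> real"
  assumes cont: "continuous_on {0..} F" and [measurable]: "F \<in> borel_measurable borel"
    and bound: "\<And>t. \<bar>F t\<bar> \<le> B" and a: "0 < a"
  shows "(\<lambda>n. (\<Sum>k<n. \<integral>t. F (t / real n) \<partial>gamma_distribution (a * (real k + 1))) / real n)
    \<longlonglongrightarrow> integral {0..a} F / a"
proof (rule LIMSEQ_I)
  fix r :: real assume r: "0 < r"
  obtain C where C0: "0 \<le> C"
    and C: "\<And>s t. 0 \<le> s \<Longrightarrow> s \<le> a \<Longrightarrow> 0 \<le> t \<Longrightarrow> \<bar>F t - F s\<bar> \<le> r/4 + C * (t - s)\<^sup>2"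
    using quadratic_modulus_of_continuity[OF cont bound, of "r/4" a] r by auto
  have bnd: "\<bar>(\<Sum>k<n. \<integral>t. F (t / real n) \<partial>gamma_distribution (a * (real k + 1))) / real n - integral {0..a} F / a\<bar>
      \<le> r/2 + (C * a / real n + C * (a / real n)\<^sup>2)" if n: "n > 0" for n :: nat
  proof -
    define h where "h = a / real n"
    have h: "0 < h" "h * real n = a" using a n by (auto simp: h_def)
    define E where "E k = (\<integral>t. F (t / real n) \<partial>gamma_distribution (a * (real k + 1)))" for k
    define J where "J k = integral {h * real k..h * real k + h} F" for k
    have cell: "\<bar>E k / real n - J k / a\<bar> \<le> (r/2 + (C * a / real n + C * h\<^sup>2)) / real n" if k: "k < n" for k
    proof -
      define s where "s = a * (real k + 1)"
      have s: "0 < s" "s / real n = h * real k + h"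
        using a n by (simp_all add: s_def h_def add_divide_distrib distrib_left)
          (use a in \<open>auto intro: add_nonneg_pos\<close>)
      have "h * (real k + 1) \<le> h * real n"
        using k h by (intro mult_left_mono) auto
      then have le: "h * real k + h \<le> a" "s \<le> a * real n"
        using h k a by (simp add: distrib_left) (use k a in \<open>auto simp: s_def intro!: mult_left_mono\<close>)
      have "\<bar>E k - F (s / real n)\<bar> \<le> r/4 + C * s / (real n)\<^sup>2"
        unfolding E_def s_def[symmetric]
        by (rule gamma_distribution_expectation_bound[where B = B, OF _ bound s(1)])
           (use n le s h C in auto)
      also have "C * s / (real n)\<^sup>2 \<le> C * (a * real n) / (real n)\<^sup>2"
        using C0 le by (intro divide_right_mono mult_left_mono) auto
      also have "\<dots> = C * a / real n"
        using n by (simp add: power2_eq_square)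
      finally have 1: "\<bar>E k - F (s / real n)\<bar> \<le> r/4 + C * a / real n" by simp
      have nonneg: "0 \<le> t" if "h * real k \<le> t" for t
        using that h by (intro order_trans[OF _ that]) simp
      have "\<bar>h * F (h * real k + h) - J k\<bar> \<le> h * (r/4 + C * h\<^sup>2)"
        unfolding J_def using h le C0
        by (intro riemann_cell_bound C continuous_on_subset[OF cont]) (auto intro: nonneg)
      then have "\<bar>h * F (s / real n) - J k\<bar> / a \<le> h * (r/4 + C * h\<^sup>2) / a"
        using a unfolding s by (intro divide_right_mono) auto
      also have "h * (r/4 + C * h\<^sup>2) / a = (r/4 + C * h\<^sup>2) / real n"
        using a by (simp add: h_def)
      also have "\<bar>h * F (s / real n) - J k\<bar> / a = \<bar>F (s / real n) / real n - J k / a\<bar>"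
      proof -
        have "F (s / real n) / real n - J k / a = (h * F (s / real n) - J k) / a"
          using a by (simp add: h_def diff_divide_distrib)
        then show ?thesis using a by (simp add: abs_divide)
      qed
      finally have 2: "\<bar>F (s / real n) / real n - J k / a\<bar> \<le> (r/4 + C * h\<^sup>2) / real n" .
      have "\<bar>E k / real n - F (s / real n) / real n\<bar> = \<bar>E k - F (s / real n)\<bar> / real n"
        by (simp add: diff_divide_distrib[symmetric] abs_divide)
      also have "\<dots> \<le> (r/4 + C * a / real n) / real n"
        using 1 by (rule divide_right_mono) auto
      finally have "\<bar>E k / real n - J k / a\<bar> \<le> (r/4 + C * a / real n) / real n + (r/4 + C * h\<^sup>2) / real n"
        using 2 by linarith
      also have "\<dots> = (r/2 + (C * a / real n + C * h\<^sup>2)) / real n"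
        by (simp add: add_divide_distrib[symmetric])
      finally show ?thesis .
    qed
    have "(\<Sum>k<n. E k) / real n - integral {0..a} F / a = (\<Sum>k<n. E k / real n - J k / a)"
      using integral_sum_cells[OF cont h(1), of n] h(2)
      by (simp add: J_def sum_subtractf sum_divide_distrib[symmetric])
    also have "\<bar>\<dots>\<bar> \<le> (\<Sum>k<n. (r/2 + (C * a / real n + C * h\<^sup>2)) / real n)"
      by (intro order_trans[OF sum_abs] sum_mono cell) auto
    also have "\<dots> = r/2 + (C * a / real n + C * h\<^sup>2)"
      using n by simp
    finally show ?thesis by (simp add: E_def h_def)
  qed
  have "(\<lambda>n. C * a / real n + C * (a / real n)\<^sup>2) \<longlonglongrightarrow> 0 + C * 0\<^sup>2"
    by (intro tendsto_intros lim_const_over_n)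
  then obtain N where N: "\<And>n. n \<ge> N \<Longrightarrow> \<bar>C * a / real n + C * (a / real n)\<^sup>2\<bar> < r/2"
    using r LIMSEQ_D[of _ 0 "r/2"] by fastforce
  show "\<exists>no. \<forall>n\<ge>no. norm ((\<Sum>k<n. \<integral>t. F (t / real n) \<partial>gamma_distribution (a * (real k + 1))) / real n
      - integral {0..a} F / a) < r"
  proof (intro exI[of _ "max N 1"] allI impI)
    fix n assume "max N 1 \<le> n"
    then have "N \<le> n" "0 < n" by auto
    then show "norm ((\<Sum>k<n. \<integral>t. F (t / real n) \<partial>gamma_distribution (a * (real k + 1))) / real n
      - integral {0..a} F / a) < r"
      using N[of n] bnd[of n] unfolding real_norm_def by linarith
  qed
qed

section \<open>Circular means\<close>

text \<open>The mean of \<open>f\<close> over the circle \<open>|z|\<^sup>p = u\<close>.\<close>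
definition angular_mean :: "real \<Rightarrow> (complex \<Rightarrow> real) \<Rightarrow> real \<Rightarrow> real" where
  "angular_mean p f u = (\<integral>\<theta>. f (powr_polar p (u, \<theta>)) \<partial>uniform_angle)"

lemma borel_measurable_angular_mean [measurable]:
  assumes [measurable]: "f \<in> borel_measurable borel"
  shows "angular_mean p f \<in> borel_measurable borel"
proof -
  interpret U: prob_space uniform_angle by (rule prob_space_uniform_angle)
  show ?thesis unfolding angular_mean_def by measurable
qed

lemma abs_angular_mean_le:
  assumes [measurable]: "f \<in> borel_measurable borel" and B: "\<And>z. \<bar>f z\<bar> \<le> B"
  shows "\<bar>angular_mean p f u\<bar> \<le> B"
proof -
  interpret U: prob_space uniform_angle by (rule prob_space_uniform_angle)
  have "\<bar>angular_mean p f u\<bar> \<le> (\<integral>\<theta>. \<bar>f (powr_polar p (u, \<theta>))\<bar> \<partial>uniform_angle)"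
    unfolding angular_mean_def by (rule integral_abs_bound)
  also have "\<dots> \<le> (\<integral>\<theta>. B \<partial>uniform_angle)"
    by (intro integral_mono U.integrable_const_bound[where B = B])
      (use B order_trans[OF abs_ge_zero B[of 0]] in auto)
  also have "\<dots> = B" using U.prob_space by simp
  finally show ?thesis .
qed

text \<open>The half line includes the degenerate circle \<open>u = 0\<close>, where \<open>u powr (1/p)\<close> is continuous because
  \<open>p > 0\<close>.\<close>
lemma continuous_on_angular_mean:
  assumes f: "continuous_on UNIV f" and B: "\<And>z. \<bar>f z\<bar> \<le> B" and p: "0 < p"
  shows "continuous_on {0..} (angular_mean p f)"
  unfolding continuous_on_sequentially comp_def
proof (intro allI ballI impI, elim conjE)
  interpret U: prob_space uniform_angle by (rule prob_space_uniform_angle)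
  have [measurable]: "f \<in> borel_measurable borel"
    using f by (rule borel_measurable_continuous_onI)
  fix x a assume x: "\<forall>n. x n \<in> {0..}" "a \<in> {0..}" "x \<longlonglongrightarrow> (a :: real)"
  have c: "continuous_on {0..} (\<lambda>u. f (powr_polar p (u, \<theta>)))" for \<theta>
    unfolding powr_polar_def using p
    by (auto intro!: continuous_intros continuous_on_compose2[OF f] continuous_on_powr')
  show "(\<lambda>n. angular_mean p f (x n)) \<longlonglongrightarrow> angular_mean p f a"
    unfolding angular_mean_def
  proof (rule integral_dominated_convergence[where w = "\<lambda>_. B"])
    show "AE \<theta> in uniform_angle. (\<lambda>n. f (powr_polar p (x n, \<theta>))) \<longlonglongrightarrow> f (powr_polar p (a, \<theta>))"
      using continuous_on_tendsto_compose[OF c x(3,2)] x(1) by simp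
  qed (use B in auto)
qed

lemma integral_distr_powr_polar:
  fixes f :: "complex \<Rightarrow> real"
  assumes T: "prob_space T" and [measurable_cong]: "sets T = sets borel"
    and [measurable]: "f \<in> borel_measurable borel" and B: "\<And>z. \<bar>f z\<bar> \<le> B"
  shows "(\<integral>z. f z \<partial>distr (T \<Otimes>\<^sub>M uniform_angle) borel (powr_polar p)) = (\<integral>t. angular_mean p f t \<partial>T)"
proof -
  interpret T: prob_space T by (rule T)
  interpret U: prob_space uniform_angle by (rule prob_space_uniform_angle)
  interpret P: pair_prob_space T uniform_angle ..
  have "(\<integral>z. f z \<partial>distr (T \<Otimes>\<^sub>M uniform_angle) borel (powr_polar p))
      = (\<integral>x. f (powr_polar p x) \<partial>(T \<Otimes>\<^sub>M uniform_angle))"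
    by (rule integral_distr) measurable
  also have "\<dots> = (\<integral>t. \<integral>\<theta>. f (powr_polar p (t, \<theta>)) \<partial>uniform_angle \<partial>T)"
    by (rule P.integral_fst'[symmetric], rule P.integrable_const_bound[where B = B]) (use B in auto)
  finally show ?thesis unfolding angular_mean_def .
qed

lemma prob_space_distr_powr_polar:
  assumes T: "prob_space T" and [measurable_cong]: "sets T = sets borel"
  shows "prob_space (distr (T \<Otimes>\<^sub>M uniform_angle) borel (powr_polar p))"
proof -
  interpret T: prob_space T by (rule T)
  interpret U: prob_space uniform_angle by (rule prob_space_uniform_angle)
  interpret P: pair_prob_space T uniform_angle ..
  show ?thesis by (rule P.prob_space_distr) measurable
qed

section \<open>The expected empirical distribution\<close>

lemma borel_measurable_radial_density [measurable]: "radial_density p k \<in> borel_measurable borel"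
  unfolding radial_density_def by measurable

lemma radial_density_nonneg: "0 < p \<Longrightarrow> 0 \<le> radial_density p k z"
  unfolding radial_density_def by (intro mult_nonneg_nonneg divide_nonneg_nonneg Gamma_real_pos[THEN less_imp_le]) auto

lemma prob_space_density_radial_density:
  assumes p: "0 < p"
  shows "prob_space (density lborel (\<lambda>z. ennreal (radial_density p k z)))"
  unfolding density_radial_density[OF p] using p
  by (intro prob_space_distr_powr_polar prob_space_gamma_distribution) auto

lemma nn_integral_radial_density:
  assumes p: "0 < p"
  shows "(\<integral>\<^sup>+z. ennreal (radial_density p k z) \<partial>lborel) = 1"
  using prob_space.emeasure_space_1[OF prob_space_density_radial_density[OF p, of k]]
  by (simp add: emeasure_density)

lemma alpha_kernel_diagonal:
  "alpha_kernel p n z z = of_real (\<Sum>k<n. radial_density p k z)"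
proof -
  have "(z * cnj z) ^ k = of_real (norm z ^ (2*k))" for k
    by (simp add: complex_norm_square[symmetric] power_mult)
  then show ?thesis
    unfolding alpha_kernel_def radial_density_def by (simp add: sum_distrib_left mult_ac)
qed

text \<open>Only the one-point intensity of the process enters.  It is the kernel on the diagonal.\<close>
lemma determinantal_process_intensity:
  assumes det: "determinantal_process M n (alpha_kernel p n) X" and p: "0 < p"
    and [measurable]: "B \<in> sets borel"
  shows "(\<integral>\<^sup>+\<omega>. of_nat (card (X \<omega> \<inter> B)) \<partial>M)
    = (\<integral>\<^sup>+z. ennreal (\<Sum>k<n. radial_density p k z) * indicator B z \<partial>lborel)"
proof -
  interpret product_sigma_finite "\<lambda>_::nat. lborel :: complex measure" ..
  obtain \<rho> where \<rho>: "joint_intensity M X 1 \<rho>"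
    and \<rho>_det: "\<And>x. complex_of_real (\<rho> x) = Determinant.det (Matrix.mat 1 1 (\<lambda>(i, j). alpha_kernel p n (x i) (x j)))"
    using det unfolding determinantal_process_def by blast
  have "complex_of_real (\<rho> x) = of_real (\<Sum>k<n. radial_density p k (x 0))" for x
    unfolding \<rho>_det by (subst det_single) (auto simp: alpha_kernel_diagonal)
  then have \<rho>_eq: "\<rho> x = (\<Sum>k<n. radial_density p k (x 0))" for x
    using of_real_eq_iff by blast
  \<comment> \<open>Pass from the product measure over the single index \<open>0\<close> to Lebesgue measure on the plane.\<close>
  have "(\<integral>\<^sup>+\<omega>. (\<Prod>i<Suc 0. of_nat (card (X \<omega> \<inter> B))) \<partial>M)
      = (\<integral>\<^sup>+x \<in> Pi\<^sub>E {..<Suc 0} (\<lambda>_. B). ennreal (\<rho> x) \<partial>(Pi\<^sub>M {..<Suc 0} (\<lambda>_. lborel)))"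
    using \<rho>[unfolded joint_intensity_def One_nat_def, THEN conjunct2, THEN conjunct2, THEN spec[of _ "\<lambda>_. B"]]
    by (auto simp: disjoint_family_on_def)
  then have "(\<integral>\<^sup>+\<omega>. of_nat (card (X \<omega> \<inter> B)) \<partial>M)
      = (\<integral>\<^sup>+x \<in> Pi\<^sub>E {0} (\<lambda>_. B). ennreal (\<rho> x) \<partial>(Pi\<^sub>M {0} (\<lambda>_. lborel)))"
    by (simp add: lessThan_Suc)
  also have "\<dots> = (\<integral>\<^sup>+x. ennreal (\<Sum>k<n. radial_density p k (x 0)) * indicator B (x 0) \<partial>(Pi\<^sub>M {0::nat} (\<lambda>_. lborel)))"
    by (intro nn_integral_cong) (auto simp: \<rho>_eq space_PiM PiE_iff indicator_def)
  also have "\<dots> = (\<integral>\<^sup>+z. ennreal (\<Sum>k<n. radial_density p k z) * indicator B z \<partial>lborel)"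
    by (rule product_nn_integral_singleton) measurable
  finally show ?thesis .
qed

text \<open>The intensity formula holds for every Borel set, so the set function that defines the expected
  empirical distribution is countably additive and the constructed measure takes these values.\<close>
lemma expected_empirical_dilate_eq:
  assumes det: "determinantal_process M n (alpha_kernel p n) X" and p: "0 < p" and c: "c \<noteq> 0"
    and n: "0 < n"
  shows "expected_empirical M n (\<lambda>\<omega>. dilate c (X \<omega>))
    = distr (density lborel (\<lambda>z. ennreal ((\<Sum>k<n. radial_density p k z) / real n))) borel (\<lambda>z. of_real c * z)"
    (is "_ = ?N")
proof -
  have "(\<integral>\<^sup>+\<omega>. of_nat (card (dilate c (X \<omega>) \<inter> B)) \<partial>M) / of_nat n = emeasure ?N B"
    if B [measurable]: "B \<in> sets borel" for B
  proof -
    define B' where "B' = (\<lambda>z::complex. of_real c * z) -` B"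
    have B' [measurable]: "B' \<in> sets borel"
      unfolding B'_def using measurable_sets[of "\<lambda>z::complex. of_real c * z" borel borel B] by simp
    have "card (dilate c (X \<omega>) \<inter> B) = card (X \<omega> \<inter> B')" for \<omega>
    proof -
      have "dilate c (X \<omega>) \<inter> B = (\<lambda>z. of_real c * z) ` (X \<omega> \<inter> B')"
        by (auto simp: dilate_def B'_def)
      then show ?thesis using c by (simp add: card_image inj_on_def)
    qed
    then have "(\<integral>\<^sup>+\<omega>. of_nat (card (dilate c (X \<omega>) \<inter> B)) \<partial>M) / of_nat n
        = (\<integral>\<^sup>+z. ennreal (\<Sum>k<n. radial_density p k z) * indicator B' z \<partial>lborel) / of_nat n"
      by (simp add: determinantal_process_intensity[OF det p B'])
    also have "\<dots> = (\<integral>\<^sup>+z. ennreal (\<Sum>k<n. radial_density p k z) * indicator B' z / of_nat n \<partial>lborel)"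
      by (rule nn_integral_divide[symmetric]) measurable
    also have "\<dots> = (\<integral>\<^sup>+z. ennreal ((\<Sum>k<n. radial_density p k z) / real n) * indicator B' z \<partial>lborel)"
      using n by (intro nn_integral_cong)
        (auto simp: indicator_def divide_ennreal[symmetric] sum_nonneg radial_density_nonneg[OF p] ennreal_of_nat_eq_real_of_nat)
    also have "\<dots> = emeasure ?N B"
      by (simp add: emeasure_distr emeasure_density B'_def[symmetric])
    finally show ?thesis .
  qed
  then have "expected_empirical M n (\<lambda>\<omega>. dilate c (X \<omega>)) = measure_of UNIV (sets borel) (emeasure ?N)"
    unfolding expected_empirical_def
    by (intro measure_of_eq) (use sets.sigma_sets_eq[of "borel :: complex measure"] in auto)
  also have "\<dots> = ?N"
    using measure_of_of_measure[of ?N] by simp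
  finally show ?thesis .
qed

lemma prob_space_mean_radial_density:
  assumes p: "0 < p" and n: "0 < n"
  shows "prob_space (density lborel (\<lambda>z. ennreal ((\<Sum>k<n. radial_density p k z) / real n)))"
proof
  have "(\<integral>\<^sup>+z. ennreal ((\<Sum>k<n. radial_density p k z) / real n) \<partial>lborel)
      = (\<integral>\<^sup>+z. (\<Sum>k<n. ennreal (radial_density p k z)) / of_nat n \<partial>lborel)"
    using n by (intro nn_integral_cong)
      (simp add: divide_ennreal[symmetric] sum_nonneg radial_density_nonneg[OF p] ennreal_of_nat_eq_real_of_nat sum_ennreal)
  also have "\<dots> = (\<integral>\<^sup>+z. (\<Sum>k<n. ennreal (radial_density p k z)) \<partial>lborel) / of_nat n"
    by (rule nn_integral_divide) measurable
  also have "\<dots> = (\<Sum>k<n. (\<integral>\<^sup>+z. ennreal (radial_density p k z) \<partial>lborel)) / of_nat n"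
    by (subst nn_integral_sum) auto
  also have "\<dots> = 1"
    using n by (simp add: nn_integral_radial_density[OF p] ennreal_of_nat_eq_real_of_nat divide_ennreal)
  finally show "emeasure (density lborel (\<lambda>z. ennreal ((\<Sum>k<n. radial_density p k z) / real n)))
      (space (density lborel (\<lambda>z. ennreal ((\<Sum>k<n. radial_density p k z) / real n)))) = 1"
    by (simp add: emeasure_density)
qed

section \<open>Weak convergence\<close>

text \<open>Scaling the plane by \<open>n powr (- 1/p)\<close> divides \<open>|z|\<^sup>p\<close> by \<open>n\<close>.\<close>
lemma integral_rescaled_mean_radial_density:
  fixes f :: "complex \<Rightarrow> real"
  assumes [measurable]: "f \<in> borel_measurable borel" and B: "\<And>z. \<bar>f z\<bar> \<le> B"
    and p: "0 < p" and n: "0 < n"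
  shows "(\<integral>z. f z \<partial>distr (density lborel (\<lambda>z. ennreal ((\<Sum>k<n. radial_density p k z) / real n)))
        borel (\<lambda>z. of_real (real n powr (- 1 / p)) * z))
    = (\<Sum>k<n. \<integral>t. angular_mean p f (t / real n) \<partial>gamma_distribution (2/p * (real k + 1))) / real n"
proof -
  define c where "c = real n powr (- 1 / p)"
  define h where "h z = f (of_real c * z)" for z :: complex
  have [measurable]: "h \<in> borel_measurable borel" unfolding h_def by measurable
  have hB: "\<bar>h z\<bar> \<le> B" for z unfolding h_def by (rule B)
  have h_mean: "angular_mean p h t = angular_mean p f (t / real n)" if t: "0 < t" for t
  proof -
    have "c * t powr (1/p) = (t / real n) powr (1/p)"
      using t n by (simp add: c_def powr_divide powr_minus field_simps)
    then have "of_real c * powr_polar p (t, \<theta>) = powr_polar p (t / real n, \<theta>)" for \<theta>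
      by (simp add: powr_polar_def mult.assoc[symmetric] flip: of_real_mult)
    then show ?thesis by (simp add: angular_mean_def h_def)
  qed
  have term1: "integrable lborel (\<lambda>z. radial_density p k z * h z)"
    and term2: "(\<integral>z. radial_density p k z * h z \<partial>lborel)
      = (\<integral>t. angular_mean p f (t / real n) \<partial>gamma_distribution (2/p * (real k + 1)))" for k
  proof -
    interpret N: prob_space "density lborel (\<lambda>z. ennreal (radial_density p k z))"
      by (rule prob_space_density_radial_density[OF p])
    have "integrable (density lborel (\<lambda>z. ennreal (radial_density p k z))) h"
      by (rule N.integrable_const_bound[where B = B]) (use hB in auto)
    then show "integrable lborel (\<lambda>z. radial_density p k z * h z)"
      by (subst (asm) integrable_density) (auto simp: radial_density_nonneg[OF p])
    have "(\<integral>z. radial_density p k z * h z \<partial>lborel)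
        = (\<integral>z. h z \<partial>density lborel (\<lambda>z. ennreal (radial_density p k z)))"
      by (subst integral_density) (auto simp: radial_density_nonneg[OF p])
    also have "\<dots> = (\<integral>t. angular_mean p h t \<partial>gamma_distribution (2/p * (real k + 1)))"
      unfolding density_radial_density[OF p]
      using p by (intro integral_distr_powr_polar[where B = B] prob_space_gamma_distribution hB) auto
    also have "\<dots> = (\<integral>t. angular_mean p f (t / real n) \<partial>gamma_distribution (2/p * (real k + 1)))"
      using AE_gamma_distribution_pos[of "2/p * (real k + 1)"]
      by (intro integral_cong_AE) (auto simp: h_mean)
    finally show "(\<integral>z. radial_density p k z * h z \<partial>lborel)
      = (\<integral>t. angular_mean p f (t / real n) \<partial>gamma_distribution (2/p * (real k + 1)))" .
  qed
  have "(\<integral>z. f z \<partial>distr (density lborel (\<lambda>z. ennreal ((\<Sum>k<n. radial_density p k z) / real n)))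
        borel (\<lambda>z. of_real c * z))
      = (\<integral>z. h z \<partial>density lborel (\<lambda>z. ennreal ((\<Sum>k<n. radial_density p k z) / real n)))"
    unfolding h_def by (rule integral_distr) measurable
  also have "\<dots> = (\<integral>z. (\<Sum>k<n. radial_density p k z) / real n * h z \<partial>lborel)"
    by (subst integral_density) (auto simp: radial_density_nonneg[OF p] sum_nonneg)
  also have "\<dots> = (\<integral>z. (\<Sum>k<n. radial_density p k z * h z) / real n \<partial>lborel)"
    by (simp add: sum_distrib_right)
  also have "\<dots> = (\<Sum>k<n. \<integral>z. radial_density p k z * h z \<partial>lborel) / real n"
    by (simp add: Bochner_Integration.integral_sum[OF term1])
  finally show ?thesis by (simp add: term2 c_def)
qed

lemma integral_limit_measure:
  fixes f :: "complex \<Rightarrow> real"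
  assumes f: "continuous_on UNIV f" and B: "\<And>z. \<bar>f z\<bar> \<le> B" and p: "0 < p"
  shows "(\<integral>z. f z \<partial>limit_measure p) = integral {0..2/p} (angular_mean p f) / (2/p)"
proof -
  have [measurable]: "f \<in> borel_measurable borel"
    using f by (rule borel_measurable_continuous_onI)
  have a: "0 < 2/p" using p by simp
  have "(\<integral>z. f z \<partial>limit_measure p) = (\<integral>t. angular_mean p f t \<partial>uniform_measure lborel {0<..<2/p})"
    unfolding limit_measure_eq_distr_powr_polar[OF p] using a
    by (intro integral_distr_powr_polar[where B = B] prob_space_uniform_measure B) auto
  also have "uniform_measure lborel {0<..<2/p} = density lborel (\<lambda>t. ennreal (indicator {0<..<2/p} t / (2/p)))"
  proof -
    have "1 / ennreal (2/p) = ennreal (1 / (2/p))"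
      using p divide_ennreal[of 1 "2/p"] by simp
    then have "indicator {0<..<2/p} t / ennreal (2/p) = ennreal (indicator {0<..<2/p} t / (2/p))" for t :: real
      by (cases "t \<in> {0<..<2/p}") simp_all
    moreover have "emeasure lborel {0<..<2/p} = ennreal (2/p)"
      using p by simp
    ultimately show ?thesis unfolding uniform_measure_def by (simp only:)
  qed
  also have "(\<integral>t. angular_mean p f t \<partial>\<dots>) = (\<integral>t. indicator {0<..<2/p} t *\<^sub>R angular_mean p f t / (2/p) \<partial>lborel)"
    using p by (subst integral_density) (auto simp: field_simps)
  also have "\<dots> = (LINT t:{0<..<2/p}|lborel. angular_mean p f t) / (2/p)"
    unfolding set_lebesgue_integral_def by (rule integral_divide_zero)
  also have "(LINT t:{0<..<2/p}|lborel. angular_mean p f t) = integral {0<..<2/p} (angular_mean p f)"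
  proof (rule set_borel_integral_eq_integral(2))
    have "set_integrable lborel {0..2/p} (angular_mean p f)"
      by (intro borel_integrable_atLeastAtMost' continuous_on_subset[OF continuous_on_angular_mean[OF f B p]]) auto
    then show "set_integrable lborel {0<..<2/p} (angular_mean p f)"
      by (rule set_integrable_subset) auto
  qed
  also have "\<dots> = integral {0..2/p} (angular_mean p f)"
    by (rule integral_open_interval_real[symmetric])
  finally show ?thesis .
qed

theorem theorem3p3:
  fixes \<alpha> :: real
    and M :: "nat \<Rightarrow> 'w measure"
    and X :: "nat \<Rightarrow> 'w \<Rightarrow> complex set"
  assumes "\<alpha> > 0"
    and "\<And>n. n \<ge> 1 \<Longrightarrow> determinantal_process (M n) n (alpha_kernel \<alpha> n) (X n)"
  shows "weakly_converges
           (\<lambda>n. expected_empirical (M n) n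
                  (\<lambda>\<omega>. dilate (real n powr (- 1 / \<alpha>)) (X n \<omega>)))
           (limit_measure \<alpha>)"
proof -
  have eq: "expected_empirical (M n) n (\<lambda>\<omega>. dilate (real n powr (- 1 / \<alpha>)) (X n \<omega>))
      = distr (density lborel (\<lambda>z. ennreal ((\<Sum>k<n. radial_density \<alpha> k z) / real n))) borel
          (\<lambda>z. of_real (real n powr (- 1 / \<alpha>)) * z)" if "n \<ge> 1" for n
    using that assms by (intro expected_empirical_dilate_eq) auto
  have "borel_prob (expected_empirical (M n) n (\<lambda>\<omega>. dilate (real n powr (- 1 / \<alpha>)) (X n \<omega>)))"
    if "n \<ge> 1" for n
    unfolding eq[OF that] borel_prob_def using that assms(1)
    by (auto intro!: prob_space.prob_space_distr prob_space_mean_radial_density)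
  then have "\<forall>\<^sub>F n in sequentially.
      borel_prob (expected_empirical (M n) n (\<lambda>\<omega>. dilate (real n powr (- 1 / \<alpha>)) (X n \<omega>)))"
    by (intro eventually_sequentiallyI[of 1])
  moreover have "borel_prob (limit_measure \<alpha>)"
    unfolding limit_measure_eq_distr_powr_polar[OF assms(1)] borel_prob_def using assms(1)
    by (auto intro!: prob_space_distr_powr_polar prob_space_uniform_measure)
  moreover have "(\<lambda>n. \<integral>z. f z \<partial>expected_empirical (M n) n (\<lambda>\<omega>. dilate (real n powr (- 1 / \<alpha>)) (X n \<omega>)))
      \<longlonglongrightarrow> (\<integral>z. f z \<partial>limit_measure \<alpha>)"
    if f: "continuous_on UNIV f" "bounded (range f)" for f :: "complex \<Rightarrow> real"
  proof -
    obtain B where B: "\<And>z. \<bar>f z\<bar> \<le> B"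
      using f(2) unfolding bounded_iff by auto
    have [measurable]: "f \<in> borel_measurable borel"
      using f(1) by (rule borel_measurable_continuous_onI)
    have "(\<lambda>n. (\<Sum>k<n. \<integral>t. angular_mean \<alpha> f (t / real n) \<partial>gamma_distribution (2/\<alpha> * (real k + 1))) / real n)
        \<longlonglongrightarrow> integral {0..2/\<alpha>} (angular_mean \<alpha> f) / (2/\<alpha>)"
      using assms(1)
      by (intro gamma_average_tendsto[where B = B] continuous_on_angular_mean[OF f(1) B]
          abs_angular_mean_le B) auto
    moreover have "\<forall>\<^sub>F n in sequentially.
      (\<Sum>k<n. \<integral>t. angular_mean \<alpha> f (t / real n) \<partial>gamma_distribution (2/\<alpha> * (real k + 1))) / real n
      = (\<integral>z. f z \<partial>expected_empirical (M n) n (\<lambda>\<omega>. dilate (real n powr (- 1 / \<alpha>)) (X n \<omega>)))"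
      using eventually_ge_at_top[of 1]
    proof eventually_elim
      case (elim n)
      then show ?case
        unfolding eq[OF elim] using assms(1)
        by (subst integral_rescaled_mean_radial_density[OF _ B]) auto
    qed
    ultimately show ?thesis
      unfolding integral_limit_measure[OF f(1) B assms(1)] by (rule Lim_transform_eventually)
  qed
  ultimately show ?thesis
    unfolding weakly_converges_def by blast
qed

end
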